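(* Let $P$ be a Fano polytope in $\mathbb{R}^2$ and let $\mathrm{Spec}_P^{\mathrm{geo}}(z)=\sum_{i=1}^{\mu_P}z^{\beta_i}$ be its geometric spectrum. Then $$\sum_{i=1}^{\mu_P}(\beta_i-1)^2=\frac{\mu_P}{6}+\frac{\mu_{P^\circ}}{6},$$ where $P^\circ$ is the polar polytope of $P$.
   Context: Let $N=\mathbb{Z}^2$, $M$ its dual lattice, $N_{\mathbb{R}}=\mathbb{R}^2$, $M_{\mathbb{R}}=M\otimes\mathbb{R}$, with pairing $\langle\ ,\ \rangle$. A Fano polytope in $N_{\mathbb{R}}$ is a full dimensional (2-dimensional) lattice polytope (convex hull of a finite subset of $N$) containing the origin in its interior, whose vertices are primitive lattice points of $N$ (it is not required to be smooth). The polar polytope is $P^\circ=\{m\in M_{\mathbb{R}}:\langle m,x\rangle\le1\ \text{for all } x\in P\}$ (a polygon with rational vertices in general). $\mu_P:=2!\,\mathrm{vol}(P)$ and $\mu_{P^\circ}:=2!\,\mathrm{vol}(P^\circ)$, volumes being normalized so that the unit square (of the lattice $N$, resp. $M$) has volume $1$. For each facet $F$ of $P$ let $u_F\in M_{\mathbb{Q}}$ be such that $P\subset\{\langle u_F,\cdot\rangle\le1\}$ and $F=P\cap\{\langle u_F,\cdot\rangle=1\}$; the Newton function of $P$ is $\nu(v)=\max_F\langle u_F,v\rangle$. The geometric spectrum is $\mathrm{Spec}_P^{\mathrm{geo}}(z):=(z-1)^2\sum_{v\in N}z^{-\nu(v)}$ (a formal series in $z^{-1/k}$ for a suitable integer $k\ge1$,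 convergent for real $z>1$); it is a finite sum $\sum_{i=1}^{\mu_P}z^{\beta_i}$ with $\beta_1\le\dots\le\beta_{\mu_P}$ non-negative rational numbers. *)

theory Defs
  imports "HOL-Analysis.Analysis"
begin

text \<open>Both \<open>N\<^sub>\<real>\<close> and its dual \<open>M\<^sub>\<real>\<close> are modelled by \<^typ>\<open>real^2\<close>, the pairing being the standard
  inner product; the lattices \<open>N\<close> and \<open>M\<close> then both become the set of integral vectors.\<close>

definition lattice_points :: "(real^2) set" where
  "lattice_points = {v. \<forall>i. v $ i \<in> \<int>}"

definition rational_points :: "(real^2) set" where
  "rational_points = {v. \<forall>i. v $ i \<in> \<rat>}"

text \<open>The zero vector is not primitive, since it equals \<open>2 *\<^sub>R 0\<close>.\<close>

definition primitive :: "real^2 \<Rightarrow> bool" where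
  "primitive v \<longleftrightarrow> v \<in> lattice_points \<and>
     (\<forall>w\<in>lattice_points. \<forall>k::nat. v = real k *\<^sub>R w \<longrightarrow> k = 1)"

definition lattice_polytope :: "(real^2) set \<Rightarrow> bool" where
  "lattice_polytope P \<longleftrightarrow> (\<exists>S. finite S \<and> S \<subseteq> lattice_points \<and> P = convex hull S)"

definition fano_polytope :: "(real^2) set \<Rightarrow> bool" where
  "fano_polytope P \<longleftrightarrow> lattice_polytope P \<and> aff_dim P = 2 \<and> 0 \<in> interior P \<and>
     (\<forall>v. v extreme_point_of P \<longrightarrow> primitive v)"

definition polar :: "(real^2) set \<Rightarrow> (real^2) set" where
  "polar P = {m. \<forall>x\<in>P. m \<bullet> x \<le> 1}"

definition normalized_volume :: "(real^2) set \<Rightarrow> real" where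
  "normalized_volume P = fact 2 * measure lebesgue P"

text \<open>The vector \<open>u\<^sub>F\<close>. For a facet (edge) \<open>F\<close> of a Fano polytope it exists, and it is unique
  because \<open>F\<close> spans a line that avoids the origin.\<close>

definition facet_normal :: "(real^2) set \<Rightarrow> (real^2) set \<Rightarrow> real^2" where
  "facet_normal P F = (THE u. u \<in> rational_points \<and>
     P \<subseteq> {x. u \<bullet> x \<le> 1} \<and> F = P \<inter> {x. u \<bullet> x = 1})"

definition newton_function :: "(real^2) set \<Rightarrow> real^2 \<Rightarrow> real" where
  "newton_function P v = Max ((\<lambda>F. facet_normal P F \<bullet> v) ` {F. F facet_of P})"

text \<open>The formal series in fractional powers of \<open>1/z\<close> is represented by its sum, a function of
  the real variable \<open>z > 1\<close>, where it converges.\<close>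

definition geo_spectrum :: "(real^2) set \<Rightarrow> real \<Rightarrow> real" where
  "geo_spectrum P z =
     (z - 1)^2 * (\<Sum>\<^sub>\<infinity>v\<in>lattice_points. z powr (- newton_function P v))"

end

theory Submission
  imports Defs "HOL-Real_Asymp.Real_Asymp" "HOL-Number_Theory.Cong"
begin

text \<open>
Let \<open>\<nu>\<close> be the Newton function of \<open>P\<close> and \<open>S(t)\<close> the sum of \<open>exp (- t \<nu>(v))\<close> over all lattice
points \<open>v\<close>. With \<open>z = exp t\<close> the definition of the spectrum says that the sum of
\<open>exp (t (\<beta> i - 1))\<close> over \<open>i\<close> equals \<open>(exp (t/2) - exp (- t/2))\<^sup>2 S(t)\<close>, and the first factor is
\<open>t\<^sup>2 + t\<^sup>4/12 + \<dots>\<close>. If \<open>S(t) = a/t\<^sup>2 + b/t + c + o(1)\<close> as \<open>t\<close> decreases to \<open>0\<close>, then comparing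
the Taylor coefficients of order \<open>0\<close> and \<open>2\<close> gives \<open>a = \<mu>\<close> and \<open>\<Sum>(\<beta> i - 1)\<^sup>2 = \<mu>/6 + 2c\<close>
(\<open>second_moment_of_const_term\<close>). So only the constant term \<open>c\<close> of \<open>S\<close> matters, and the claim is
that \<open>c\<close> is one sixth of the area of the polar polygon (\<open>fano_lattice_sum\<close>).

To find \<open>c\<close>, cut the plane into parallel lattice lines, in a direction that is parallel to no edge
of \<open>P\<close> and to the position vector of no vertex; a shear of the lattice makes these lines vertical.
For \<open>x > 0\<close> the function \<open>\<nu>\<close> on the line with first coordinate \<open>x\<close> is \<open>y \<mapsto> x h(y/x)\<close>, where \<open>h\<close>
is the maximum of the affine functions \<open>s \<mapsto> \<alpha> + \<beta> s\<close> given by the facet normals \<open>(\<alpha>, \<beta>)\<close>. The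
sum along the line is geometric between any two kinks of \<open>h\<close>, hence is a sum over the kinks alone.
A kink is the slope \<open>s = q/p\<close> of a vertex \<open>(p, q)\<close> of \<open>P\<close>; since the vertex is primitive,
\<open>p\<close> and \<open>q\<close> are coprime, and \<open>h(s) = 1/p\<close> because \<open>\<nu>\<close> is \<open>1\<close> at the vertex. The subsequent sum
over \<open>x\<close> is geometric on each residue class modulo \<open>p\<close>. Expanding
\<open>exp (\<tau> \<theta>) / (exp \<tau> - 1) = 1/\<tau> + B\<^sub>1(\<theta>) + \<tau> B\<^sub>2(\<theta>)/2 + \<dots>\<close>, in which the Dedekind-like sums of
products of two values of \<open>B\<^sub>1\<close> are the same for the two edges at the vertex and cancel, and using that
the values of \<open>B\<^sub>2\<close> at \<open>0, 1/p, \<dots>, (p-1)/p\<close> add up to \<open>1/(6p)\<close>, a vertex between facets with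
normals \<open>(\<alpha>, \<beta>)\<close> and \<open>(\<alpha>', \<beta>')\<close> contributes \<open>(1/\<beta>' - 1/\<beta> + \<beta>' - \<beta>)/(12 p)\<close> to \<open>c\<close>
(\<open>kink_contribution\<close>).

The parts with \<open>1/\<beta>\<close> telescope along each half plane, and the two half planes cancel. What remains is
\<open>(\<beta>' - \<beta>) h(s)/12 = (\<alpha> \<beta>' - \<alpha>' \<beta>)/12\<close>, one twelfth of the determinant of two consecutive vertices
of the polar polygon. By the shoelace formula these determinants add up to twice its area; here
this is obtained by integrating the lengths of its chords (\<open>emeasure_common_minorants\<close>).
\<close>

section \<open>Constant terms of Laurent expansions\<close>

text \<open>For \<open>\<tau> > 0\<close> this is the sum of the geometric progression \<open>exp (\<tau> (\<theta> - n))\<close>, \<open>n \<ge> 1\<close>;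
as a function of \<open>\<tau>\<close> it is the generating function of the Bernoulli polynomials, divided by \<open>\<tau>\<close>.\<close>

definition todd :: "real \<Rightarrow> real \<Rightarrow> real" where
  "todd \<tau> \<theta> = exp (\<tau> * \<theta>) / (exp \<tau> - 1)"

definition bern2 :: "real \<Rightarrow> real" where
  "bern2 \<theta> = \<theta>\<^sup>2 - \<theta> + 1/6"

definition has_const_term :: "(real \<Rightarrow> real) \<Rightarrow> real \<Rightarrow> bool" where
  "has_const_term f c \<longleftrightarrow> (\<exists>a b. ((\<lambda>t. f t - a / t\<^sup>2 - b / t) \<longlongrightarrow> c) (at_right 0))"

lemma todd_expansion:
  "((\<lambda>\<tau>. (todd \<tau> \<theta> - 1/\<tau> - (\<theta> - 1/2)) / \<tau>) \<longlongrightarrow> bern2 \<theta> / 2) (at 0)"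
  unfolding filterlim_at_split todd_def bern2_def
  by (rule conjI; real_asymp simp: field_simps power2_eq_square)

lemma has_const_term_add:
  assumes "has_const_term f c" "has_const_term g d"
  shows "has_const_term (\<lambda>t. f t + g t) (c + d)"
proof -
  obtain a b a' b' where
    "((\<lambda>t. f t - a / t\<^sup>2 - b / t) \<longlongrightarrow> c) (at_right 0)"
    "((\<lambda>t. g t - a' / t\<^sup>2 - b' / t) \<longlongrightarrow> d) (at_right 0)"
    using assms unfolding has_const_term_def by blast
  from tendsto_add[OF this]
  have "((\<lambda>t. (f t + g t) - (a + a') / t\<^sup>2 - (b + b') / t) \<longlongrightarrow> c + d) (at_right 0)"
    by (simp add: add_divide_distrib algebra_simps)
  then show ?thesis unfolding has_const_term_def by blast
qed

lemma has_const_term_cmult: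
  assumes "has_const_term f c"
  shows "has_const_term (\<lambda>t. k * f t) (k * c)"
proof -
  obtain a b where "((\<lambda>t. f t - a / t\<^sup>2 - b / t) \<longlongrightarrow> c) (at_right 0)"
    using assms unfolding has_const_term_def by blast
  from tendsto_mult_left[OF this, of k]
  have "((\<lambda>t. k * f t - (k * a) / t\<^sup>2 - (k * b) / t) \<longlongrightarrow> k * c) (at_right 0)"
    by (simp add: algebra_simps)
  then show ?thesis unfolding has_const_term_def by blast
qed

lemma has_const_term_diff:
  assumes "has_const_term f c" "has_const_term g d"
  shows "has_const_term (\<lambda>t. f t - g t) (c - d)"
  using has_const_term_add[OF assms(1) has_const_term_cmult[OF assms(2), of "-1"]] by simp

lemma has_const_term_const: "has_const_term (\<lambda>t. k) k"
  unfolding has_const_term_def by (intro exI[of _ 0]) simp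

lemma has_const_term_sum:
  assumes "\<And>i. i \<in> I \<Longrightarrow> has_const_term (f i) (c i)"
  shows "has_const_term (\<lambda>t. \<Sum>i\<in>I. f i t) (\<Sum>i\<in>I. c i)"
  using assms
  by (induction I rule: infinite_finite_induct)
     (auto intro: has_const_term_add has_const_term_const)

lemma todd_expansion_scaled:
  assumes "\<beta> \<noteq> 0"
  shows "((\<lambda>t. (todd (t * \<beta>) \<theta> - 1 / (t * \<beta>) - (\<theta> - 1/2)) / t) \<longlongrightarrow> \<beta> * bern2 \<theta> / 2) (at_right 0)"
proof -
  have "filterlim (\<lambda>t. t * \<beta>) (at 0) (at_right (0::real))"
    unfolding filterlim_at using assms
    by (auto intro!: tendsto_eq_intros eventually_at_rightI[of 0 1])
  from filterlim_compose[OF todd_expansion this]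
  have "((\<lambda>t. \<beta> * ((todd (t * \<beta>) \<theta> - 1 / (t * \<beta>) - (\<theta> - 1/2)) / (t * \<beta>))) \<longlongrightarrow> \<beta> * (bern2 \<theta> / 2)) (at_right 0)"
    by (intro tendsto_mult_left)
  then show ?thesis using assms by simp
qed

lemma has_const_term_todd:
  assumes "\<beta> \<noteq> 0"
  shows "has_const_term (\<lambda>t. todd (t * \<beta>) \<theta>) (\<theta> - 1/2)"
proof -
  have "((\<lambda>t. t * ((todd (t * \<beta>) \<theta> - 1 / (t * \<beta>) - (\<theta> - 1/2)) / t) + (\<theta> - 1/2)) \<longlongrightarrow> 0 * (\<beta> * bern2 \<theta> / 2) + (\<theta> - 1/2)) (at_right 0)"
    by (intro tendsto_intros todd_expansion_scaled assms)
  moreover have "\<forall>\<^sub>F t in at_right 0. t * ((todd (t * \<beta>) \<theta> - 1 / (t * \<beta>) - (\<theta> - 1/2)) / t) + (\<theta> - 1/2)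
      = todd (t * \<beta>) \<theta> - 0 / t\<^sup>2 - (1/\<beta>) / t"
    using assms by (intro eventually_at_rightI[of 0 1]) (auto simp: field_simps)
  ultimately have "((\<lambda>t. todd (t * \<beta>) \<theta> - 0 / t\<^sup>2 - (1/\<beta>) / t) \<longlongrightarrow> 0 * (\<beta> * bern2 \<theta> / 2) + (\<theta> - 1/2)) (at_right 0)"
    by (rule Lim_transform_eventually)
  then show ?thesis unfolding has_const_term_def by (intro exI[of _ 0] exI[of _ "1/\<beta>"]) simp
qed

text \<open>The product of the two expansions \<open>1/t + B\<^sub>1 + t B\<^sub>2/2 + \<dots>\<close>. In the constant term only the mixed
product of the linear Bernoulli polynomials does not depend on \<open>\<beta>\<close>, so it disappears when two
such products with different \<open>\<beta>\<close> are subtracted.\<close>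

lemma has_const_term_todd_product:
  assumes "\<beta> \<noteq> 0"
  shows "has_const_term (\<lambda>t. todd t \<phi> * todd (t * \<beta>) \<theta>)
    (bern2 \<phi> / (2 * \<beta>) + (\<phi> - 1/2) * (\<theta> - 1/2) + \<beta> * bern2 \<theta> / 2)"
proof -
  define \<rho> where "\<rho> = (\<lambda>t. (todd t \<phi> - 1 / t - (\<phi> - 1/2)) / t)"
  define \<sigma> where "\<sigma> = (\<lambda>t. (todd (t * \<beta>) \<theta> - 1 / (t * \<beta>) - (\<theta> - 1/2)) / t)"
  have \<rho>: "(\<rho> \<longlongrightarrow> bern2 \<phi> / 2) (at_right 0)"
    using todd_expansion_scaled[of 1 \<phi>] unfolding \<rho>_def by simp
  have \<sigma>: "(\<sigma> \<longlongrightarrow> \<beta> * bern2 \<theta> / 2) (at_right 0)"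
    using todd_expansion_scaled[OF assms, of \<theta>] unfolding \<sigma>_def .
  define b where "b = (\<theta> - 1/2) + (\<phi> - 1/2) / \<beta>"
  have "((\<lambda>t. \<rho> t / \<beta> + (\<phi> - 1/2) * (\<theta> - 1/2) + \<sigma> t + t * ((\<phi> - 1/2) * \<sigma> t + (\<theta> - 1/2) * \<rho> t) + t\<^sup>2 * (\<rho> t * \<sigma> t))
     \<longlongrightarrow> (bern2 \<phi> / 2) / \<beta> + (\<phi> - 1/2) * (\<theta> - 1/2) + \<beta> * bern2 \<theta> / 2
       + 0 * ((\<phi> - 1/2) * (\<beta> * bern2 \<theta> / 2) + (\<theta> - 1/2) * (bern2 \<phi> / 2)) + 0\<^sup>2 * ((bern2 \<phi> / 2) * (\<beta> * bern2 \<theta> / 2))) (at_right 0)"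
    by (intro tendsto_intros \<rho> \<sigma> assms)
  moreover have "\<forall>\<^sub>F t in at_right 0.
      \<rho> t / \<beta> + (\<phi> - 1/2) * (\<theta> - 1/2) + \<sigma> t + t * ((\<phi> - 1/2) * \<sigma> t + (\<theta> - 1/2) * \<rho> t) + t\<^sup>2 * (\<rho> t * \<sigma> t)
      = todd t \<phi> * todd (t * \<beta>) \<theta> - (1/\<beta>) / t\<^sup>2 - b / t"
  proof (intro eventually_at_rightI[of 0 1])
    fix t :: real assume t: "t \<in> {0<..<1}"
    have 1: "todd t \<phi> = 1 / t + (\<phi> - 1/2) + t * \<rho> t" using t by (simp add: \<rho>_def)
    have 2: "todd (t * \<beta>) \<theta> = 1 / (t * \<beta>) + (\<theta> - 1/2) + t * \<sigma> t" using t by (simp add: \<sigma>_def)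
    show "\<rho> t / \<beta> + (\<phi> - 1/2) * (\<theta> - 1/2) + \<sigma> t + t * ((\<phi> - 1/2) * \<sigma> t + (\<theta> - 1/2) * \<rho> t) + t\<^sup>2 * (\<rho> t * \<sigma> t)
      = todd t \<phi> * todd (t * \<beta>) \<theta> - (1/\<beta>) / t\<^sup>2 - b / t"
      unfolding 1 2 b_def using t assms by (simp add: field_simps power2_eq_square)
  qed auto
  ultimately have "((\<lambda>t. todd t \<phi> * todd (t * \<beta>) \<theta> - (1/\<beta>) / t\<^sup>2 - b / t) \<longlongrightarrow>
     (bern2 \<phi> / 2) / \<beta> + (\<phi> - 1/2) * (\<theta> - 1/2) + \<beta> * bern2 \<theta> / 2
       + 0 * ((\<phi> - 1/2) * (\<beta> * bern2 \<theta> / 2) + (\<theta> - 1/2) * (bern2 \<phi> / 2)) + 0\<^sup>2 * ((bern2 \<phi> / 2) * (\<beta> * bern2 \<theta> / 2))) (at_right 0)"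
    by (rule Lim_transform_eventually)
  then show ?thesis unfolding has_const_term_def
    by (intro exI[of _ "1/\<beta>"] exI[of _ b]) (simp add: mult.commute)
qed

text \<open>After multiplication by \<open>exp (- t)\<close> the left-hand side becomes the exponential generating function of
the moments of the \<open>\<beta> i - 1\<close>, and the factor in front of \<open>f\<close> becomes \<open>t\<^sup>2 + t\<^sup>4/12 + \<dots>\<close>. Comparing
the orders \<open>0\<close>, \<open>1\<close>, \<open>2\<close> successively identifies both polar coefficients of \<open>f\<close> and then the second
moment.\<close>

lemma second_moment_of_const_term:
  fixes \<beta> :: "'i \<Rightarrow> real"
  assumes f: "has_const_term f c"
    and eq: "\<And>t. t > 0 \<Longrightarrow> (\<Sum>i\<in>I. exp (t * \<beta> i)) = (exp t - 1)\<^sup>2 * f t"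
  shows "(\<Sum>i\<in>I. (\<beta> i - 1)\<^sup>2) = real (card I) / 6 + 2 * c"
proof -
  obtain a b where r: "((\<lambda>t. f t - a / t\<^sup>2 - b / t) \<longlongrightarrow> c) (at_right 0)"
    using f unfolding has_const_term_def by blast
  define r where "r = (\<lambda>t. f t - a / t\<^sup>2 - b / t)"
  define \<gamma> where "\<gamma> = (\<lambda>t::real. (exp (- t) * (exp t - 1)\<^sup>2 / t\<^sup>2 - 1) / t\<^sup>2)"
  define E where "E = (\<lambda>t. \<Sum>i\<in>I. (exp (t * (\<beta> i - 1)) - 1 - t * (\<beta> i - 1)) / t\<^sup>2)"
  define n where "n = real (card I)"
  define m where "m = (\<Sum>i\<in>I. \<beta> i - 1)"
  have rlim: "(r \<longlongrightarrow> c) (at_right 0)" using r by (simp add: r_def)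
  have \<gamma>lim: "(\<gamma> \<longlongrightarrow> 1 / 12) (at_right 0)" unfolding \<gamma>_def by real_asymp
  have "((\<lambda>t. (exp (t * d) - 1 - t * d) / t\<^sup>2) \<longlongrightarrow> d\<^sup>2 / 2) (at_right 0)" for d :: real
    by (real_asymp simp: field_simps power2_eq_square)
  then have Elim: "(E \<longlongrightarrow> (\<Sum>i\<in>I. (\<beta> i - 1)\<^sup>2 / 2)) (at_right 0)"
    unfolding E_def by (intro tendsto_sum)
  \<comment> \<open>The coefficient of order \<open>2\<close>, including the remainders; \<open>\<gamma>\<close> tends to \<open>1/12\<close>.\<close>
  define D where "D = (\<lambda>t. r t + \<gamma> t * (a + b * t + t\<^sup>2 * r t) - E t)"
  have Dlim: "(D \<longlongrightarrow> c + 1 / 12 * (a + b * 0 + 0\<^sup>2 * c) - (\<Sum>i\<in>I. (\<beta> i - 1)\<^sup>2 / 2)) (at_right 0)"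
    unfolding D_def by (intro tendsto_intros rlim \<gamma>lim Elim)
  have key: "(a - n) + (b - m) * t + t\<^sup>2 * D t = 0" if t: "t > 0" for t
  proof -
    have "(\<Sum>i\<in>I. exp (t * (\<beta> i - 1))) = exp (- t) * (\<Sum>i\<in>I. exp (t * \<beta> i))"
      unfolding sum_distrib_left by (intro sum.cong) (auto simp: algebra_simps simp flip: exp_add)
    also have "\<dots> = (exp (- t) * (exp t - 1)\<^sup>2) * f t" using eq[OF t] by simp
    also have "exp (- t) * (exp t - 1)\<^sup>2 = t\<^sup>2 * (1 + t\<^sup>2 * \<gamma> t)" using t by (simp add: \<gamma>_def)
    also have "f t = a / t\<^sup>2 + b / t + r t" by (simp add: r_def)
    also have "t\<^sup>2 * (1 + t\<^sup>2 * \<gamma> t) * (a / t\<^sup>2 + b / t + r t)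
        = a + b * t + t\<^sup>2 * (r t + \<gamma> t * (a + b * t + t\<^sup>2 * r t))"
      using t by (simp add: field_simps power2_eq_square)
    finally have 1: "(\<Sum>i\<in>I. exp (t * (\<beta> i - 1))) = \<dots>" .
    have "(\<Sum>i\<in>I. exp (t * (\<beta> i - 1))) = (\<Sum>i\<in>I. 1 + t * (\<beta> i - 1) + t\<^sup>2 * ((exp (t * (\<beta> i - 1)) - 1 - t * (\<beta> i - 1)) / t\<^sup>2))"
      using t by (intro sum.cong) auto
    also have "\<dots> = n + t * m + t\<^sup>2 * E t"
      by (simp only: sum.distrib sum_distrib_left[symmetric] E_def m_def n_def) simp
    finally show ?thesis using 1 by (simp add: D_def algebra_simps)
  qed
  have lim0: "((\<lambda>t::real. t) \<longlongrightarrow> 0) (at_right 0)" by (rule tendsto_ident_at)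
  have zero: "l = 0" if "(h \<longlongrightarrow> l) (at_right 0)" "\<And>t. t > 0 \<Longrightarrow> h t = 0" for h :: "real \<Rightarrow> real" and l
  proof -
    have "((\<lambda>t. 0) \<longlongrightarrow> l) (at_right (0::real))"
      by (rule Lim_transform_eventually[OF that(1)]) (use that(2) in \<open>auto intro: eventually_at_rightI[of 0 1]\<close>)
    then show ?thesis by (simp add: tendsto_const_iff)
  qed
  have "a - n + (b - m) * 0 + 0\<^sup>2 * (c + 1 / 12 * (a + b * 0 + 0\<^sup>2 * c) - (\<Sum>i\<in>I. (\<beta> i - 1)\<^sup>2 / 2)) = 0"
  proof (rule zero[OF _ key])
    show "((\<lambda>t. a - n + (b - m) * t + t\<^sup>2 * D t) \<longlongrightarrow> a - n + (b - m) * 0 + 0\<^sup>2 * (c + 1 / 12 * (a + b * 0 + 0\<^sup>2 * c) - (\<Sum>i\<in>I. (\<beta> i - 1)\<^sup>2 / 2))) (at_right 0)"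
      by (intro tendsto_intros Dlim)
  qed
  then have a: "a = n" by simp
  have "(b - m) + 0 * (c + 1 / 12 * (a + b * 0 + 0\<^sup>2 * c) - (\<Sum>i\<in>I. (\<beta> i - 1)\<^sup>2 / 2)) = 0"
  proof (rule zero[of "\<lambda>t. (b - m) + t * D t"])
    show "((\<lambda>t. b - m + t * D t) \<longlongrightarrow> b - m + 0 * (c + 1 / 12 * (a + b * 0 + 0\<^sup>2 * c) - (\<Sum>i\<in>I. (\<beta> i - 1)\<^sup>2 / 2))) (at_right 0)"
      by (intro tendsto_intros Dlim)
    show "b - m + t * D t = 0" if "t > 0" for t
    proof -
      have "t * (b - m + t * D t) = 0" using key[OF that] a by (simp add: power2_eq_square algebra_simps)
      then show ?thesis using that by simp
    qed
  qed
  then have b: "b = m" by simp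
  have "c + 1 / 12 * (a + b * 0 + 0\<^sup>2 * c) - (\<Sum>i\<in>I. (\<beta> i - 1)\<^sup>2 / 2) = 0"
    by (rule zero[OF Dlim]) (use key a b in auto)
  then show ?thesis using a by (simp add: n_def flip: sum_divide_distrib)
qed

section \<open>Bernoulli sums over residue classes\<close>

text \<open>The multiplication theorem for the second Bernoulli polynomial, at the argument \<open>0\<close>.\<close>

lemma bern2_sum:
  assumes "p > 0"
  shows "(\<Sum>j<p. bern2 (real j / real p)) = 1 / (6 * real p)"
proof -
  have s1: "(\<Sum>j<n. real j) = real n * (real n - 1) / 2" for n
    by (induction n) (auto simp: field_simps)
  have s2: "(\<Sum>j<n. (real j)\<^sup>2) = (real n - 1) * real n * (2 * real n - 1) / 6" for n
    by (induction n) (auto simp: field_simps power2_eq_square)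
  have "(\<Sum>j<p. bern2 (real j / real p)) = (\<Sum>j<p. (real j)\<^sup>2) / (real p)\<^sup>2 - (\<Sum>j<p. real j) / real p + real p / 6"
    unfolding bern2_def by (simp add: sum.distrib sum_subtractf sum_divide_distrib power_divide)
  also have "\<dots> = 1 / (6 * real p)" unfolding s1 s2 using assms
    by (simp add: field_simps power2_eq_square)
  finally show ?thesis .
qed

lemma bern2_sum_reversed:
  assumes "p > 0"
  shows "(\<Sum>r\<in>{1..p}. bern2 (1 - real r / real p)) = 1 / (6 * real p)"
proof -
  have "(\<Sum>r\<in>{1..p}. bern2 (1 - real r / real p)) = (\<Sum>j<p. bern2 (real j / real p))"
    using assms by (intro sum.reindex_bij_witness[of _ "\<lambda>j. p - j" "\<lambda>r. p - r"])
      (auto simp: of_nat_diff field_simps)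
  then show ?thesis using bern2_sum[OF assms] by simp
qed

lemma frac_div_int:
  assumes "p > 0"
  shows "frac (real_of_int a / real p) = real_of_int (a mod int p) / real p"
proof -
  have "a = int p * (a div int p) + a mod int p" by simp
  then have "real_of_int a = real p * real_of_int (a div int p) + real_of_int (a mod int p)"
    by (metis of_int_add of_int_mult of_int_of_nat_eq)
  then have "real_of_int a / real p = real_of_int (a div int p) + real_of_int (a mod int p) / real p"
    using assms by (simp add: field_simps)
  moreover have "0 \<le> a mod int p" "a mod int p < int p" using assms by auto
  then have "0 \<le> real_of_int (a mod int p)" "real_of_int (a mod int p) < real p" by linarith+
  then have "0 \<le> real_of_int (a mod int p) / real p" "real_of_int (a mod int p) / real p < 1"
    using assms by simp_all
  ultimately show ?thesis by (simp add: frac_unique_iff)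
qed

text \<open>Multiplication by a unit permutes the residues modulo \<open>p\<close>.\<close>

lemma bern2_sum_permuted:
  assumes "p > 0" "coprime q (int p)"
  shows "(\<Sum>r\<in>{1..p}. bern2 (frac (real r * (real_of_int q / real p)))) = 1 / (6 * real p)"
proof -
  define g where "g = (\<lambda>r::nat. nat ((int r * q) mod int p))"
  have inj: "inj_on g {1..p}"
  proof (rule inj_onI)
    fix r s assume rs: "r \<in> {1..p}" "s \<in> {1..p}" "g r = g s"
    then have "(int r * q) mod int p = (int s * q) mod int p"
      using assms eq_nat_nat_iff[of "int r * q mod int p" "int s * q mod int p"] by (simp add: g_def)
    then have "[int r * q = int s * q] (mod int p)" by (simp add: cong_def)
    then have "[int r = int s] (mod int p)" using assms cong_mult_rcancel by blast
    then have d: "int p dvd int r - int s" by (simp add: cong_iff_dvd_diff)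
    have "\<bar>int r - int s\<bar> < int p" using rs by auto
    with d show "r = s" using dvd_imp_le_int[of "int r - int s" "int p"] by fastforce
  qed
  have im: "g ` {1..p} \<subseteq> {..<p}" using assms by (auto simp: g_def nat_less_iff)
  have "bij_betw g {1..p} {..<p}"
    unfolding bij_betw_def using inj card_subset_eq[OF _ im] card_image[OF inj] by simp
  then have "(\<Sum>r\<in>{1..p}. bern2 (real (g r) / real p)) = (\<Sum>j<p. bern2 (real j / real p))"
    by (rule sum.reindex_bij_betw)
  moreover have "frac (real r * (real_of_int q / real p)) = real (g r) / real p" for r
    using frac_div_int[OF assms(1), of "int r * q"] assms by (simp add: g_def)
  ultimately show ?thesis using bern2_sum[OF assms(1)] by simp
qed

text \<open>Blocks of length \<open>p\<close> form a geometric progression of ratio \<open>c\<close>, which bounds the partial sums of the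
absolute values. The total then solves the linear equation obtained by shifting the series by \<open>p\<close>.\<close>

lemma has_sum_quasiperiodic:
  fixes f :: "nat \<Rightarrow> real"
  assumes p: "p > 0" and c: "0 < c" "c < 1"
    and f: "\<And>x. f (x + p) = c * f x"
  shows "((\<lambda>n. f (Suc n)) has_sum (\<Sum>r\<in>{1..p}. f r) / (1 - c)) UNIV"
proof -
  define M where "M = (\<Sum>r<p. \<bar>f (Suc r)\<bar>)"
  have pow: "f (Suc (r + k * p)) = c ^ k * f (Suc r)" for r k
  proof (induction k)
    case (Suc k)
    then show ?case using f[of "Suc (r + k * p)"] by (simp add: add_ac)
  qed simp
  have partial: "(\<Sum>n<k * p. \<bar>f (Suc n)\<bar>) = (\<Sum>j<k. c ^ j * M)" for k
  proof (induction k)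
    case (Suc k)
    have "(\<Sum>n<Suc k * p. \<bar>f (Suc n)\<bar>) = (\<Sum>n<k * p. \<bar>f (Suc n)\<bar>) + (\<Sum>n\<in>{k*p..<k*p+p}. \<bar>f (Suc n)\<bar>)"
      by (simp add: add.commute sum.atLeastLessThan_concat lessThan_atLeast0)
    also have "(\<Sum>n\<in>{k*p..<k*p+p}. \<bar>f (Suc n)\<bar>) = (\<Sum>r<p. \<bar>f (Suc (r + k * p))\<bar>)"
      by (intro sum.reindex_bij_witness[of _ "\<lambda>r. r + k * p" "\<lambda>n. n - k * p"]) auto
    also have "\<dots> = c ^ k * M" using c by (simp only: pow) (simp add: M_def sum_distrib_left abs_mult)
    finally show ?case using Suc by simp
  qed auto
  have M0: "M \<ge> 0" by (simp add: M_def sum_nonneg)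
  have bound: "(\<Sum>n<N. \<bar>f (Suc n)\<bar>) \<le> M / (1 - c)" for N
  proof -
    have "(\<Sum>n<N. \<bar>f (Suc n)\<bar>) \<le> (\<Sum>n<N * p. \<bar>f (Suc n)\<bar>)"
      using p by (intro sum_mono2) auto
    also have "\<dots> = M * (\<Sum>j<N. c ^ j)" by (simp add: partial sum_distrib_left mult.commute)
    also have "\<dots> \<le> M * (1 / (1 - c))"
    proof (intro mult_left_mono M0)
      have "(\<Sum>j<N. c ^ j) \<le> (\<Sum>j. c ^ j)" using c by (intro sum_le_suminf summable_geometric) auto
      then show "(\<Sum>j<N. c ^ j) \<le> 1 / (1 - c)" using c by (simp add: suminf_geometric)
    qed
    finally show ?thesis by simp
  qed
  have "summable (\<lambda>n. \<bar>f (Suc n)\<bar>)"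
    by (rule summableI_nonneg_bounded[where x = "M / (1 - c)"]) (use bound in auto)
  then have S: "summable (\<lambda>n. norm (f (Suc n)))" by simp
  then have S': "summable (\<lambda>n. f (Suc n))" by (rule summable_norm_cancel)
  have "suminf (\<lambda>n. f (Suc n)) = (\<Sum>n. f (Suc (n + p))) + (\<Sum>n<p. f (Suc n))"
    using suminf_split_initial_segment[OF S', of p] by simp
  also have "(\<Sum>n. f (Suc (n + p))) = c * suminf (\<lambda>n. f (Suc n))"
  proof -
    have "f (Suc (n + p)) = c * f (Suc n)" for n using f[of "Suc n"] by simp
    then show ?thesis using suminf_mult[OF S', of c] by simp
  qed
  finally have "suminf (\<lambda>n. f (Suc n)) * (1 - c) = (\<Sum>n<p. f (Suc n))" by (simp add: algebra_simps)
  moreover have "(\<Sum>n<p. f (Suc n)) = (\<Sum>r\<in>{1..p}. f r)"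
    by (intro sum.reindex_bij_witness[of _ "\<lambda>r. r - 1" Suc]) auto
  ultimately have "suminf (\<lambda>n. f (Suc n)) = (\<Sum>r\<in>{1..p}. f r) / (1 - c)"
    using c by (simp add: field_simps)
  then show ?thesis
    using norm_summable_imp_has_sum[OF S] summable_sums[OF S'] by simp
qed

section \<open>Upper envelopes of affine functions\<close>

text \<open>A pair \<open>(\<alpha>, \<beta>)\<close> stands for an affine function with slope \<open>\<beta>\<close>; in the application it is a facet
normal of the polygon, that is, a vertex of the polar polygon.\<close>

definition aff :: "real \<times> real \<Rightarrow> real \<Rightarrow> real" where
  "aff u s = fst u + snd u * s"

definition kink :: "real \<times> real \<Rightarrow> real \<times> real \<Rightarrow> real" where
  "kink u v = (fst u - fst v) / (snd v - snd u)"

definition envelope :: "(real \<times> real) set \<Rightarrow> real \<Rightarrow> real" where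
  "envelope W s = Max ((\<lambda>w. aff w s) ` W)"

text \<open>The list enumerates, by increasing slope, affine pieces that make up \<open>h\<close> on the half line
from \<open>a\<close>. Consecutive kinks may coincide, so a piece may be reduced to a point.\<close>

fun chain_from :: "(real \<Rightarrow> real) \<Rightarrow> real \<Rightarrow> (real \<times> real) list \<Rightarrow> bool" where
  "chain_from h a [] \<longleftrightarrow> False"
| "chain_from h a [u] \<longleftrightarrow> (\<forall>s\<ge>a. h s = aff u s)"
| "chain_from h a (u # v # us) \<longleftrightarrow> snd u < snd v \<and> a \<le> kink u v \<and>
     (\<forall>s. a \<le> s \<and> s \<le> kink u v \<longrightarrow> h s = aff u s) \<and> chain_from h (kink u v) (v # us)"

fun pair_sum :: "('a \<Rightarrow> 'a \<Rightarrow> real) \<Rightarrow> 'a list \<Rightarrow> real" where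
  "pair_sum \<phi> (u # v # us) = \<phi> u v + pair_sum \<phi> (v # us)"
| "pair_sum \<phi> _ = 0"

lemma aff_kink: "snd u \<noteq> snd v \<Longrightarrow> aff u (kink u v) = aff v (kink u v)"
  by (simp add: aff_def kink_def field_simps)

lemma aff_shift: "aff u s = aff u a + snd u * (s - a)"
  by (simp add: aff_def algebra_simps)

lemma le_kink_iff:
  assumes "snd u < snd v"
  shows "s \<le> kink u v \<longleftrightarrow> aff v s \<le> aff u s"
  using assms by (simp add: kink_def aff_def field_simps)

lemma envelope_attained:
  assumes "finite W" "W \<noteq> {}"
  obtains w where "w \<in> W" "envelope W s = aff w s"
  using Max_in[of "(\<lambda>w. aff w s) ` W"] assms unfolding envelope_def by fastforce

lemma aff_le_envelope: "finite W \<Longrightarrow> w \<in> W \<Longrightarrow> aff w s \<le> envelope W s"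
  unfolding envelope_def by simp

lemma envelope_eqI:
  assumes "finite W" "u \<in> W" "\<And>w. w \<in> W \<Longrightarrow> aff w s \<le> aff u s"
  shows "envelope W s = aff u s"
  unfolding envelope_def using assms by (intro Max_eqI) auto

lemma chain_from_cong:
  assumes "\<And>s. s \<ge> a \<Longrightarrow> h s = h' s" "chain_from h a us"
  shows "chain_from h' a us"
  using assms by (induction h a us rule: chain_from.induct) auto

text \<open>Walk to the right along the graph of the envelope, starting with the function \<open>u\<close> of least slope: the
next piece is any \<open>v\<close> whose graph is the first to meet that of \<open>u\<close>. Beyond this point all functions of
slope below that of \<open>v\<close> stay below \<open>v\<close> and can be discarded.\<close>

lemma chain_from_exists:
  assumes "finite W" "inj_on snd W" "u \<in> W"
    and "\<And>w. w \<in> W \<Longrightarrow> snd u \<le> snd w"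
    and "\<And>w. w \<in> W \<Longrightarrow> aff w a \<le> aff u a"
  shows "\<exists>us. chain_from (envelope W) a us \<and> hd us = u \<and> set us \<subseteq> W \<and>
    (\<forall>w\<in>W. snd w \<le> snd (last us))"
  using assms
proof (induction "card W" arbitrary: W u a rule: less_induct)
  case less
  note fin = \<open>finite W\<close> and inj = \<open>inj_on snd W\<close> and u = \<open>u \<in> W\<close>
  have umin: "snd u < snd w" if "w \<in> W" "w \<noteq> u" for w
    using less.prems(4)[OF that(1)] inj that u by (metis inj_onD order_le_less)
  show ?case
  proof (cases "W = {u}")
    case True
    then show ?thesis by (intro exI[of _ "[u]"]) (auto simp: envelope_def)
  next
    case False
    \<comment> \<open>The next kink is the leftmost crossing with the graph of another member.\<close>
    define K where "K = kink u ` (W - {u})"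
    have K: "finite K" "K \<noteq> {}" using False u fin by (auto simp: K_def)
    have "Min K \<in> kink u ` (W - {u})" using Min_in[OF K] by (simp only: K_def)
    then obtain v where "Min K = kink u v" "v \<in> W - {u}" by (rule imageE)
    then have v: "v \<in> W" "v \<noteq> u" "kink u v = Min K" by simp_all
    define b where "b = kink u v"
    have b_le: "b \<le> kink u w" if "w \<in> W" "w \<noteq> u" for w
      using that K v by (auto simp: b_def K_def intro!: Min_le)
    have uv: "aff u b = aff v b" using umin[OF v(1,2)] unfolding b_def by (intro aff_kink) simp
    have below: "aff w s \<le> aff u s" if "w \<in> W" "s \<le> b" for w s
      using le_kink_iff[OF umin[of w], of s] b_le[of w] that by (cases "w = u") auto
    have ab: "a \<le> b"
      using less.prems(5)[of v] v le_kink_iff[OF umin[of v], of a] by (simp add: b_def)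
    define W1 where "W1 = {w \<in> W. snd v \<le> snd w}"
    have W1: "finite W1" "inj_on snd W1" "v \<in> W1" "W1 \<subseteq> W" "u \<notin> W1"
      using fin inj v umin[of v] by (auto simp: W1_def intro: inj_on_subset)
    have "card W1 < card W" using W1 u fin by (intro psubset_card_mono) auto
    then obtain us where us: "chain_from (envelope W1) b us" "hd us = v" "set us \<subseteq> W1"
        "\<forall>w\<in>W1. snd w \<le> snd (last us)"
      using less.hyps[of W1 v b] W1 below uv by (force simp: W1_def)
    have env: "envelope W1 s = envelope W s" if s: "s \<ge> b" for s
    proof -
      obtain w where w: "w \<in> W1" "envelope W1 s = aff w s"
        using envelope_attained[of W1] W1 by blast
      have "aff x s \<le> aff w s" if x: "x \<in> W" for x
      proof (cases "x \<in> W1")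
        case False
        then have "snd x \<le> snd v" using x by (simp add: W1_def)
        then have "snd x * (s - b) \<le> snd v * (s - b)" using s by (intro mult_right_mono) auto
        then have "aff x s \<le> aff v s"
          using below[OF x, of b] uv aff_shift[of x s b] aff_shift[of v s b] by simp
        also have "\<dots> \<le> aff w s" using aff_le_envelope[OF W1(1,3), of s] w by simp
        finally show ?thesis .
      qed (use aff_le_envelope[OF W1(1), of x s] w in simp)
      then show ?thesis using envelope_eqI[OF fin, of w s] w W1 by auto
    qed
    obtain us' where us': "us = v # us'" using us(1,2) by (cases us) auto
    have "chain_from (envelope W) a (u # us)"
      unfolding us' chain_from.simps
      using umin[of v] v ab chain_from_cong[OF env us(1)] us' below envelope_eqI[OF fin u]
      by (auto simp: b_def)
    moreover have "snd w \<le> snd (last us)" if "w \<in> W" for w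
    proof (cases "w \<in> W1")
      case False
      then have "snd w < snd v" using that by (simp add: W1_def)
      also have "\<dots> \<le> snd (last us)" using us W1 by blast
      finally show ?thesis by simp
    qed (use us in blast)
    ultimately show ?thesis
      using us W1 u us' by (intro exI[of _ "u # us"]) auto
  qed
qed

lemma envelope_chain:
  assumes "finite W" "inj_on snd W" "W \<noteq> {}"
  obtains us a where "chain_from (envelope W) a us" "set us \<subseteq> W"
    "\<And>s. s \<le> a \<Longrightarrow> envelope W s = aff (hd us) s"
    "\<And>w. w \<in> W \<Longrightarrow> snd (hd us) \<le> snd w" "\<And>w. w \<in> W \<Longrightarrow> snd w \<le> snd (last us)"
proof -
  have "Min (snd ` W) \<in> snd ` W" using assms by (intro Min_in) auto
  then obtain u where u: "u \<in> W" "snd u = Min (snd ` W)" by auto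
  have umin: "snd u \<le> snd w" if "w \<in> W" for w using that assms u by simp
  have ustrict: "snd u < snd w" if "w \<in> W" "w \<noteq> u" for w
    using umin[OF that(1)] assms(2) that u by (metis inj_onD order_le_less)
  \<comment> \<open>Left of all crossings the function of least slope dominates; the \<open>0\<close> covers the case of a singleton.\<close>
  define a where "a = Min (insert 0 (kink u ` (W - {u})))"
  have below: "aff w s \<le> aff u s" if "w \<in> W" "s \<le> a" for w s
  proof (cases "w = u")
    case False
    have "a \<le> kink u w" unfolding a_def using assms False that by (intro Min_le) auto
    then show ?thesis using le_kink_iff[OF ustrict[OF that(1) False], of s] that by simp
  qed simp
  obtain us where "chain_from (envelope W) a us" "hd us = u" "set us \<subseteq> W"
    "\<forall>w\<in>W. snd w \<le> snd (last us)"
    using chain_from_exists[OF assms(1,2) u(1) umin below[OF _ order_refl]] by blast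
  then show ?thesis
    using that[of a us] envelope_eqI[OF assms(1) u(1)] below umin by blast
qed

lemma pair_sum_telescope:
  "us \<noteq> [] \<Longrightarrow> pair_sum (\<lambda>u v. F v - F u) us = F (last us) - F (hd us)"
  by (induction us rule: induct_list012) auto

lemma pair_sum_add: "pair_sum (\<lambda>u v. \<phi> u v + \<psi> u v) us = pair_sum \<phi> us + pair_sum \<psi> us"
  by (induction us rule: induct_list012) auto

lemma pair_sum_cmult: "pair_sum (\<lambda>u v. k * \<phi> u v) us = k * pair_sum \<phi> us"
  by (induction us rule: induct_list012) (auto simp: algebra_simps)

definition consecutive :: "'a list \<Rightarrow> ('a \<times> 'a) set" where
  "consecutive us = set (zip us (tl us))"

lemma consecutive_simps [simp]:
  "consecutive [] = {}" "consecutive [u] = {}"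
  "consecutive (u # v # us) = insert (u, v) (consecutive (v # us))"
  by (auto simp: consecutive_def)

lemma consecutive_subset: "(u, v) \<in> consecutive us \<Longrightarrow> u \<in> set us \<and> v \<in> set us"
  by (induction us rule: induct_list012) auto

lemma pair_sum_cong:
  "(\<And>u v. (u, v) \<in> consecutive us \<Longrightarrow> \<phi> u v = \<psi> u v) \<Longrightarrow> pair_sum \<phi> us = pair_sum \<psi> us"
  by (induction us rule: induct_list012) auto

lemma chain_from_consecutive:
  assumes "chain_from h a us" "(u, v) \<in> consecutive us"
  shows "snd u < snd v \<and> h (kink u v) = aff u (kink u v)"
  using assms
  by (induction h a us rule: chain_from.induct) auto

lemma has_const_term_pair_sum:
  assumes "\<And>u v. (u, v) \<in> consecutive us \<Longrightarrow> has_const_term (\<lambda>t. \<phi> t u v) (c u v)"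
  shows "has_const_term (\<lambda>t. pair_sum (\<phi> t) us) (pair_sum c us)"
  using assms
  by (induction us rule: induct_list012) (auto intro: has_const_term_add has_const_term_const)

lemma has_sum_pair_sum:
  assumes "\<And>u v. (u, v) \<in> consecutive us \<Longrightarrow> ((\<lambda>n. \<phi> n u v) has_sum S u v) A"
  shows "((\<lambda>n. pair_sum (\<phi> n) us) has_sum pair_sum S us) A"
  using assms
  by (induction us rule: induct_list012) (auto intro: has_sum_add)

section \<open>Exponential sums along a line and over a half plane\<close>

lemma has_sum_eqI: "(\<And>y. y \<in> A \<Longrightarrow> f y = g y) \<Longrightarrow> (g has_sum S) A \<Longrightarrow> (f has_sum S) A"
  using has_sum_cong[of A f g S] by blast

lemma exp_sums_above:
  fixes \<beta> :: real
  assumes "\<beta> > 0"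
  shows "((\<lambda>y::int. exp (c - \<beta> * y)) has_sum exp (c - \<beta> * m) / (exp \<beta> - 1)) {m<..}"
proof -
  have lt: "exp (- \<beta>) < 1" using assms by simp
  have "(\<lambda>n. exp (- \<beta>) ^ n) sums (1 / (1 - exp (- \<beta>)))" using lt by (intro geometric_sums) auto
  then have "((\<lambda>n. exp (- \<beta>) ^ n) has_sum (1 / (1 - exp (- \<beta>)))) UNIV"
    by (intro sums_nonneg_imp_has_sum) auto
  then have "((\<lambda>n. exp (c - \<beta> * (m + 1)) * exp (- \<beta>) ^ n) has_sum (exp (c - \<beta> * (m + 1)) * (1 / (1 - exp (- \<beta>))))) UNIV"
    by (rule has_sum_cmult_right)
  moreover have "exp (c - \<beta> * (m + 1)) * (1 / (1 - exp (- \<beta>))) = exp (c - \<beta> * m) / (exp \<beta> - 1)"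
    using assms by (simp add: exp_diff exp_minus exp_add field_simps)
  moreover have "exp (c - \<beta> * (m + 1)) * exp (- \<beta>) ^ n = exp (c - \<beta> * (m + 1 + int n))" for n
    by (simp flip: exp_of_nat_mult exp_add add: algebra_simps)
  ultimately have "((\<lambda>n. exp (c - \<beta> * (m + 1 + int n))) has_sum exp (c - \<beta> * m) / (exp \<beta> - 1)) UNIV"
    by simp
  moreover have "bij_betw (\<lambda>n. m + 1 + int n) UNIV {m<..}"
    by (rule bij_betw_byWitness[where f' = "\<lambda>y. nat (y - m - 1)"]) auto
  ultimately show ?thesis
    using has_sum_reindex_bij_betw[of "\<lambda>n. m + 1 + int n" UNIV "{m<..}" "\<lambda>y. exp (c - \<beta> * y)"] by simp
qed

lemma exp_sums_below:
  fixes \<beta> :: real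
  assumes "\<beta> < 0"
  shows "((\<lambda>y::int. exp (c - \<beta> * y)) has_sum - (exp (c - \<beta> * m) / (exp \<beta> - 1))) {..m}"
proof -
  have "((\<lambda>y::int. exp (c - (- \<beta>) * y)) has_sum exp (c - (- \<beta>) * (- m - 1)) / (exp (- \<beta>) - 1)) {- m - 1<..}"
    using exp_sums_above[of "-\<beta>" c "- m - 1"] assms by simp
  moreover have "exp (c - (- \<beta>) * (- m - 1)) / (exp (- \<beta>) - 1) = - (exp (c - \<beta> * m) / (exp \<beta> - 1))"
  proof -
    have E: "exp \<beta> \<noteq> 1" using assms by simp
    have shift: "exp (c - (- \<beta>) * (- m - 1)) = exp (c - \<beta> * m) / exp \<beta>"
      by (simp add: exp_diff exp_add exp_minus algebra_simps divide_simps)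
    have alg: "B / F / (1 / F - 1) = - (B / (F - 1))" if "F \<noteq> 0" "F \<noteq> 1" for B F :: real
      using that by (simp add: divide_simps) (simp add: algebra_simps)
    show ?thesis unfolding shift
      using alg[of "exp \<beta>" "exp (c - \<beta> * m)"] E by (simp add: exp_minus inverse_eq_divide)
  qed
  moreover have "bij_betw (\<lambda>y. - y) {- m - 1<..} {..m}"
    by (rule bij_betw_byWitness[where f' = uminus]) auto
  ultimately show ?thesis
    using has_sum_reindex_bij_betw[of "\<lambda>y. - y" "{- m - 1<..}" "{..m}" "\<lambda>y. exp (c - \<beta> * y)"] by simp
qed

lemma exp_sum_between:
  fixes \<beta> :: real
  assumes "\<beta> \<noteq> 0" "m \<le> n"
  shows "((\<lambda>y::int. exp (c - \<beta> * y)) has_sum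
    (exp (c - \<beta> * m) / (exp \<beta> - 1) - exp (c - \<beta> * n) / (exp \<beta> - 1))) {m<..n}"
proof -
  have "(\<Sum>y\<in>{m<..n}. exp (c - \<beta> * y)) = exp (c - \<beta> * m) / (exp \<beta> - 1) - exp (c - \<beta> * n) / (exp \<beta> - 1)"
    using assms(2)
  proof (induction n rule: int_ge_induct)
    case (step n)
    have E: "exp \<beta> \<noteq> 1" using assms(1) by simp
    have shift: "exp (c - \<beta> * (n + 1)) = exp (c - \<beta> * n) / exp \<beta>"
      by (simp add: exp_diff exp_add algebra_simps)
    have alg: "B / F - B / (F - 1) = - (B / F / (F - 1))" if "F \<noteq> 0" "F \<noteq> 1" for B F :: real
      using that by (simp add: divide_simps) (simp add: algebra_simps)
    have "{m<..n + 1} = insert (n + 1) {m<..n}" using step by auto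
    then have "(\<Sum>y\<in>{m<..n+1}. exp (c - \<beta> * y)) = exp (c - \<beta> * (n + 1)) + (\<Sum>y\<in>{m<..n}. exp (c - \<beta> * y))"
      by simp
    then show ?case
      using step alg[of "exp \<beta>" "exp (c - \<beta> * n)"] E shift by simp
  qed simp
  then show ?thesis by (metis finite_greaterThanAtMost_int has_sum_finite)
qed

text \<open>The sum of the full geometric progression with terms \<open>exp (- t (fst u * x + snd u * y))\<close> over the
integers \<open>y\<close> with \<open>y > x * a\<close> if it converges, and its analytic continuation in \<open>snd u\<close> otherwise.
Sums over intervals and over the opposite half line are then differences of such terms.\<close>

definition ray_term :: "real \<Rightarrow> real \<Rightarrow> real \<times> real \<Rightarrow> real \<Rightarrow> real" where
  "ray_term t x u a = exp (- (t * x * fst u) - t * snd u * \<lfloor>x * a\<rfloor>) / (exp (t * snd u) - 1)"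

lemma slice_term:
  assumes "x > 0" "h (y / x) = aff u (y / x)"
  shows "exp (- t * (x * h (y / x))) = exp (- (t * x * fst u) - t * snd u * y)"
  using assms by (simp add: aff_def field_simps)

lemma slice_sum_above:
  assumes "chain_from h a us" "t > 0" "x > 0" "\<And>u. u \<in> set us \<Longrightarrow> snd u \<noteq> 0" "snd (last us) > 0"
  shows "((\<lambda>y::int. exp (- t * (x * h (y / x)))) has_sum
    ray_term t x (hd us) a + pair_sum (\<lambda>u v. ray_term t x v (kink u v) - ray_term t x u (kink u v)) us)
    {\<lfloor>x * a\<rfloor><..}"
  using assms(1,4,5)
proof (induction h a us rule: chain_from.induct)
  case (2 h a u)
  have env: "h s = aff u s" if "s \<ge> a" for s using 2(1) that by simp
  have pos: "snd u > 0" using 2(3) by simp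
  have "exp (- t * (x * h (y / x))) = exp (- (t * x * fst u) - t * snd u * y)"
    if "y \<in> {\<lfloor>x * a\<rfloor><..}" for y :: int
  proof -
    have "x * a \<le> y" using that by (simp add: floor_less_iff)
    then have "a \<le> y / x" using \<open>x > 0\<close> by (simp add: pos_le_divide_eq mult.commute)
    from slice_term[where h = h, OF \<open>x > 0\<close> env[OF this]] show ?thesis .
  qed
  moreover have "((\<lambda>y::int. exp (- (t * x * fst u) - t * snd u * y)) has_sum ray_term t x u a) {\<lfloor>x * a\<rfloor><..}"
    using exp_sums_above[of "t * snd u" "- (t * x * fst u)" "\<lfloor>x * a\<rfloor>"] pos \<open>t > 0\<close>
    unfolding ray_term_def by simp
  ultimately have "((\<lambda>y::int. exp (- t * (x * h (y / x)))) has_sum ray_term t x u a) {\<lfloor>x * a\<rfloor><..}"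
    by (rule has_sum_eqI)
  then show ?case by simp
next
  case (3 h a u v us)
  let ?k = "kink u v"
  let ?\<phi> = "\<lambda>u v. ray_term t x v (kink u v) - ray_term t x u (kink u v)"
  have k: "a \<le> ?k" and env: "\<And>s. a \<le> s \<Longrightarrow> s \<le> ?k \<Longrightarrow> h s = aff u s"
    and tail: "chain_from h ?k (v # us)"
    using 3(2) by simp_all
  have u: "t * snd u \<noteq> 0" using 3(3)[of u] \<open>t > 0\<close> by simp
  have m: "\<lfloor>x * a\<rfloor> \<le> \<lfloor>x * ?k\<rfloor>" using k \<open>x > 0\<close> by (intro floor_mono mult_left_mono) simp_all
  have "exp (- t * (x * h (y / x))) = exp (- (t * x * fst u) - t * snd u * y)"
    if "y \<in> {\<lfloor>x * a\<rfloor><..\<lfloor>x * ?k\<rfloor>}" for y :: int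
  proof -
    have "x * a \<le> y" "y \<le> x * ?k" using that by (simp_all add: floor_less_iff le_floor_iff)
    then have "a \<le> y / x" "y / x \<le> ?k"
      using \<open>x > 0\<close> by (simp_all add: pos_le_divide_eq pos_divide_le_eq mult.commute)
    from slice_term[where h = h, OF \<open>x > 0\<close> env[OF this]] show ?thesis .
  qed
  moreover have "((\<lambda>y::int. exp (- (t * x * fst u) - t * snd u * y)) has_sum
    (ray_term t x u a - ray_term t x u ?k)) {\<lfloor>x * a\<rfloor><..\<lfloor>x * ?k\<rfloor>}"
    using exp_sum_between[OF u m, of "- (t * x * fst u)"] unfolding ray_term_def .
  ultimately have "((\<lambda>y::int. exp (- t * (x * h (y / x)))) has_sum
    (ray_term t x u a - ray_term t x u ?k)) {\<lfloor>x * a\<rfloor><..\<lfloor>x * ?k\<rfloor>}"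
    by (rule has_sum_eqI)
  moreover have "((\<lambda>y::int. exp (- t * (x * h (y / x)))) has_sum
      ray_term t x (hd (v # us)) ?k + pair_sum ?\<phi> (v # us)) {\<lfloor>x * ?k\<rfloor><..}"
    using 3(3,4) by (intro 3(1) tail) simp_all
  ultimately have "((\<lambda>y::int. exp (- t * (x * h (y / x)))) has_sum
      ((ray_term t x u a - ray_term t x u ?k) + (ray_term t x (hd (v # us)) ?k + pair_sum ?\<phi> (v # us))))
      ({\<lfloor>x * a\<rfloor><..\<lfloor>x * ?k\<rfloor>} \<union> {\<lfloor>x * ?k\<rfloor><..})"
    by (rule has_sum_Un_disjoint) auto
  moreover have "{\<lfloor>x * a\<rfloor><..\<lfloor>x * ?k\<rfloor>} \<union> {\<lfloor>x * ?k\<rfloor><..} = {\<lfloor>x * a\<rfloor><..}" using m by auto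
  ultimately show ?case by (simp add: algebra_simps)
qed simp

text \<open>Every linear piece contributes the difference of its ray terms at its two end points. Regrouped by
end points, only differences of the two pieces that meet in a kink remain.\<close>

lemma slice_sum:
  assumes "chain_from h a us" "\<And>s. s \<le> a \<Longrightarrow> h s = aff (hd us) s"
    and "t > 0" "x > 0" "\<And>u. u \<in> set us \<Longrightarrow> snd u \<noteq> 0"
    and "snd (hd us) < 0" "snd (last us) > 0"
  shows "((\<lambda>y::int. exp (- t * (x * h (y / x)))) has_sum
    pair_sum (\<lambda>u v. ray_term t x v (kink u v) - ray_term t x u (kink u v)) us) UNIV"
proof -
  let ?u = "hd us"
  have "exp (- t * (x * h (y / x))) = exp (- (t * x * fst ?u) - t * snd ?u * y)" if "y \<in> {..\<lfloor>x * a\<rfloor>}" for y :: int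
  proof -
    have "y / x \<le> a" using that \<open>x > 0\<close> by (simp add: pos_divide_le_eq le_floor_iff mult.commute)
    from slice_term[where h = h, OF \<open>x > 0\<close> assms(2)[OF this]] show ?thesis .
  qed
  moreover have "t * snd ?u < 0" using assms by (simp add: mult_pos_neg)
  then have "((\<lambda>y::int. exp (- (t * x * fst ?u) - t * snd ?u * y)) has_sum - ray_term t x ?u a) {..\<lfloor>x * a\<rfloor>}"
    using exp_sums_below[of "t * snd ?u" "- (t * x * fst ?u)" "\<lfloor>x * a\<rfloor>"]
    unfolding ray_term_def by simp
  ultimately have "((\<lambda>y::int. exp (- t * (x * h (y / x)))) has_sum - ray_term t x ?u a) {..\<lfloor>x * a\<rfloor>}"
    by (rule has_sum_eqI)
  moreover have "{..\<lfloor>x * a\<rfloor>} \<inter> {\<lfloor>x * a\<rfloor><..} = {}" "{..\<lfloor>x * a\<rfloor>} \<union> {\<lfloor>x * a\<rfloor><..} = UNIV" by auto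
  ultimately show ?thesis
    using has_sum_Un_disjoint[OF _ slice_sum_above[OF assms(1,3,4,5,7)]] by fastforce
qed

lemma ray_term_eq_todd:
  "ray_term t x u a = exp (- (t * x * aff u a)) * todd (t * snd u) (frac (x * a))"
proof -
  have E: "- (t * x * fst u) - t * snd u * \<lfloor>x * a\<rfloor> = - (t * x * aff u a) + t * snd u * frac (x * a)"
    by (simp add: aff_def frac_def algebra_simps)
  show ?thesis unfolding ray_term_def todd_def E exp_add by simp
qed

text \<open>The fractional part of \<open>x q/p\<close> depends on \<open>x\<close> only modulo \<open>p\<close>, and the exponential in front is
multiplied by \<open>exp (- t)\<close> when \<open>x\<close> grows by \<open>p\<close>. The factor \<open>1 / (1 - exp (- t))\<close> of the geometric series
combines with the exponential to a second Todd factor.\<close>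

lemma ray_term_sum:
  fixes p :: nat and q :: int
  assumes "t > 0" "p > 0" "aff u (q / p) = 1 / p"
  shows "((\<lambda>n. ray_term t (real (Suc n)) u (q / p)) has_sum
    (\<Sum>r\<in>{1..p}. todd t (1 - real r / p) * todd (t * snd u) (frac (real r * (q / p))))) UNIV"
proof -
  define f where "f = (\<lambda>n::nat. ray_term t (real n) u (q / p))"
  have f: "f n = exp (- (t * real n / p)) * todd (t * snd u) (frac (real n * (q / p)))" for n
    unfolding f_def ray_term_eq_todd assms(3) by simp
  have period: "f (n + p) = exp (- t) * f n" for n
  proof -
    have "real (n + p) * (q / p) = real n * (q / p) + of_int q" using assms(2) by (simp add: field_simps)
    then have "frac (real (n + p) * (q / p)) = frac (real n * (q / p))"
      by (simp only: frac_add_of_int_right)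
    moreover have "exp (- (t * real (n + p) / p)) = exp (- t) * exp (- (t * real n / p))"
      using assms(2) by (simp add: exp_add[symmetric] field_simps)
    ultimately show ?thesis unfolding f by simp
  qed
  have "((\<lambda>n. f (Suc n)) has_sum (\<Sum>r\<in>{1..p}. f r) / (1 - exp (- t))) UNIV"
    using assms period by (intro has_sum_quasiperiodic) auto
  moreover have "(\<Sum>r\<in>{1..p}. f r) / (1 - exp (- t)) =
    (\<Sum>r\<in>{1..p}. todd t (1 - real r / p) * todd (t * snd u) (frac (real r * (q / p))))"
    unfolding sum_divide_distrib
  proof (rule sum.cong)
    fix r
    have "exp (- (t * real r / p)) / (1 - exp (- t)) = todd t (1 - real r / p)"
    proof -
      have E: "t * (1 - real r / p) = t + - (t * real r / p)" by (simp add: algebra_simps)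
      have "1 - exp (- t) = (exp t - 1) / exp t" by (simp add: exp_minus field_simps)
      then show ?thesis unfolding todd_def E exp_add by simp
    qed
    then show "f r / (1 - exp (- t)) = todd t (1 - real r / p) * todd (t * snd u) (frac (real r * (q / p)))"
      unfolding f times_divide_eq_left[symmetric] by simp
  qed simp
  ultimately show ?thesis unfolding f_def by simp
qed

text \<open>The ray terms of both pieces have the same exponential and the same fractional parts, because the
pieces agree at the kink. Hence the Dedekind-like sum of products of linear Bernoulli polynomials
is the same for both and drops out, and only sums of values of \<open>bern2\<close> remain.\<close>

lemma kink_contribution:
  fixes p :: nat and q :: int
  assumes "p > 0" "coprime q (int p)" "kink u v = q / p" "aff u (kink u v) = 1 / p"
    and "snd u < snd v" "snd u \<noteq> 0" "snd v \<noteq> 0"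
  obtains H where
    "\<And>t. t > 0 \<Longrightarrow> ((\<lambda>n. ray_term t (real (Suc n)) v (kink u v) - ray_term t (real (Suc n)) u (kink u v))
       has_sum H t) UNIV"
    "has_const_term H (aff u (kink u v) * ((1 / snd v - 1 / snd u) + (snd v - snd u)) / 12)"
proof -
  define Q where "Q = (\<lambda>w::real\<times>real. \<lambda>t. \<Sum>r\<in>{1..p}. todd t (1 - real r / p) * todd (t * snd w) (frac (real r * (q / p))))"
  have const: "has_const_term (Q w) ((1 / snd w + snd w) / (12 * p)
      + (\<Sum>r\<in>{1..p}. ((1 - real r / p) - 1/2) * (frac (real r * (q / p)) - 1/2)))" if "snd w \<noteq> 0" for w
  proof -
    have "(\<Sum>r\<in>{1..p}. bern2 (1 - real r / p) / (2 * snd w)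
        + ((1 - real r / p) - 1/2) * (frac (real r * (q / p)) - 1/2)
        + snd w * bern2 (frac (real r * (q / p))) / 2)
      = (\<Sum>r\<in>{1..p}. bern2 (1 - real r / p)) / (2 * snd w)
        + (\<Sum>r\<in>{1..p}. ((1 - real r / p) - 1/2) * (frac (real r * (q / p)) - 1/2))
        + snd w * (\<Sum>r\<in>{1..p}. bern2 (frac (real r * (q / p)))) / 2"
      by (simp only: sum.distrib sum_divide_distrib sum_distrib_left)
    also have "\<dots> = (1 / snd w + snd w) / (12 * p)
      + (\<Sum>r\<in>{1..p}. ((1 - real r / p) - 1/2) * (frac (real r * (q / p)) - 1/2))"
      unfolding bern2_sum_reversed[OF assms(1)] bern2_sum_permuted[OF assms(1,2)]
      using that assms(1) by (simp add: field_simps)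
    finally have eq: "(\<Sum>r\<in>{1..p}. bern2 (1 - real r / p) / (2 * snd w)
        + ((1 - real r / p) - 1/2) * (frac (real r * (q / p)) - 1/2)
        + snd w * bern2 (frac (real r * (q / p))) / 2) = \<dots>" .
    show ?thesis
      unfolding Q_def eq[symmetric] by (intro has_const_term_sum has_const_term_todd_product that)
  qed
  have "aff v (kink u v) = 1 / p" using assms(4,5) aff_kink[of u v] by simp
  then have rays: "((\<lambda>n. ray_term t (real (Suc n)) w (kink u v)) has_sum Q w t) UNIV"
    if "t > 0" "w \<in> {u, v}" for t w
    using that assms(4) ray_term_sum[OF that(1) assms(1), of w q] unfolding Q_def assms(3) by blast
  have "((\<lambda>n. ray_term t (real (Suc n)) v (kink u v) - ray_term t (real (Suc n)) u (kink u v))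
       has_sum Q v t - Q u t) UNIV" if "t > 0" for t
    using has_sum_add[OF rays[OF that, of v] has_sum_cmult_right[OF rays[OF that, of u], of "-1"]] by simp
  moreover have eq: "(1 / snd v + snd v) / (12 * p) + S - ((1 / snd u + snd u) / (12 * p) + S)
      = aff u (kink u v) * ((1 / snd v - 1 / snd u) + (snd v - snd u)) / 12" for S
    using assms(4) by (simp add: add_divide_distrib diff_divide_distrib algebra_simps)
  have "has_const_term (\<lambda>t. Q v t - Q u t) (aff u (kink u v) * ((1 / snd v - 1 / snd u) + (snd v - snd u)) / 12)"
    using has_const_term_diff[OF const[OF assms(7)] const[OF assms(6)]] unfolding eq .
  ultimately show ?thesis by (rule that)
qed

definition cross :: "real \<times> real \<Rightarrow> real \<times> real \<Rightarrow> real" where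
  "cross u v = fst u * snd v - fst v * snd u"

text \<open>In the contribution of a kink, \<open>1/p\<close> is the common value of both pieces there. Multiplied with
\<open>1 / snd v - 1 / snd u\<close> it gives the difference of \<open>fst v / snd v\<close> and \<open>fst u / snd u\<close>, since the
position of the kink cancels; these differences telescope. Multiplied with \<open>snd v - snd u\<close> it gives
the determinant of \<open>u\<close> and \<open>v\<close>.\<close>

lemma half_plane_sum:
  assumes "chain_from h a us" "\<And>s. s \<le> a \<Longrightarrow> h s = aff (hd us) s"
    and nz: "\<And>u. u \<in> set us \<Longrightarrow> snd u \<noteq> 0" and "snd (hd us) < 0" "snd (last us) > 0"
    and kinks: "\<And>u v. (u, v) \<in> consecutive us \<Longrightarrow>
      \<exists>p q. p > 0 \<and> coprime q (int p) \<and> kink u v = real_of_int q / real p \<and> h (kink u v) = 1 / real p"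
  obtains H where
    "\<And>t x. t > 0 \<Longrightarrow> x > 0 \<Longrightarrow> (\<lambda>y::int. exp (- t * (x * h (y / x)))) summable_on UNIV"
    "\<And>t. t > 0 \<Longrightarrow> ((\<lambda>n. \<Sum>\<^sub>\<infinity>y::int. exp (- t * (real (Suc n) * h (y / real (Suc n))))) has_sum H t) UNIV"
    "has_const_term H ((fst (last us) / snd (last us) - fst (hd us) / snd (hd us) + pair_sum cross us) / 12)"
proof -
  have ne: "us \<noteq> []" using assms(1) by auto
  define \<phi> where "\<phi> = (\<lambda>t n u v. ray_term t (real (Suc n)) v (kink u v) - ray_term t (real (Suc n)) u (kink u v))"
  define c where "c = (\<lambda>u v. aff u (kink u v) * ((1 / snd v - 1 / snd u) + (snd v - snd u)) / 12)"
  have "\<exists>H. (\<forall>t>0. ((\<lambda>n. \<phi> t n u v) has_sum H t) UNIV) \<and> has_const_term H (c u v)"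
    if uv: "(u, v) \<in> consecutive us" for u v
  proof -
    have "snd u < snd v" "h (kink u v) = aff u (kink u v)" "snd u \<noteq> 0" "snd v \<noteq> 0"
      using chain_from_consecutive[OF assms(1) uv] consecutive_subset[OF uv] nz by auto
    moreover obtain p q where "p > 0" "coprime q (int p)" "kink u v = real_of_int q / real p"
      "h (kink u v) = 1 / real p"
      using kinks[OF uv] by blast
    ultimately obtain H where
      "\<And>t. t > 0 \<Longrightarrow> ((\<lambda>n. \<phi> t n u v) has_sum H t) UNIV" "has_const_term H (c u v)"
      unfolding \<phi>_def c_def using kink_contribution[of p q u v] by auto
    then show ?thesis by blast
  qed
  then obtain H where H: "\<And>u v t. (u, v) \<in> consecutive us \<Longrightarrow> t > 0 \<Longrightarrow> ((\<lambda>n. \<phi> t n u v) has_sum H u v t) UNIV"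
    "\<And>u v. (u, v) \<in> consecutive us \<Longrightarrow> has_const_term (H u v) (c u v)"
    by metis
  have "((\<lambda>n. \<Sum>\<^sub>\<infinity>y::int. exp (- t * (real (Suc n) * h (y / real (Suc n))))) has_sum pair_sum (\<lambda>u v. H u v t) us) UNIV"
    if "t > 0" for t
  proof -
    have "(\<Sum>\<^sub>\<infinity>y::int. exp (- t * (real (Suc n) * h (y / real (Suc n))))) = pair_sum (\<phi> t n) us" for n
      unfolding \<phi>_def using assms that by (intro infsumI slice_sum) auto
    then show ?thesis using has_sum_pair_sum[where us = us and \<phi> = "\<phi> t" and S = "\<lambda>u v. H u v t" and A = UNIV] H(1) that by simp
  qed
  moreover have "has_const_term (\<lambda>t. pair_sum (\<lambda>u v. H u v t) us) (pair_sum c us)"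
    using has_const_term_pair_sum[of us "\<lambda>t u v. H u v t" c] H(2) by blast
  moreover have "pair_sum c us =
    (fst (last us) / snd (last us) - fst (hd us) / snd (hd us) + pair_sum cross us) / 12"
  proof -
    have "pair_sum c us = pair_sum (\<lambda>u v. 1/12 * ((fst v / snd v - fst u / snd u) + cross u v)) us"
    proof (rule pair_sum_cong)
      fix u v assume uv: "(u, v) \<in> consecutive us"
      have uv': "snd u < snd v" "snd u \<noteq> 0" "snd v \<noteq> 0"
        using chain_from_consecutive[OF assms(1) uv] consecutive_subset[OF uv] nz by auto
      have "aff u (kink u v) * (1 / snd v - 1 / snd u) = aff v (kink u v) / snd v - aff u (kink u v) / snd u"
        using uv' aff_kink[of u v] by (simp add: right_diff_distrib)
      also have "\<dots> = fst v / snd v - fst u / snd u"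
        using uv' by (simp add: aff_def add_divide_distrib)
      finally have "aff u (kink u v) * (1 / snd v - 1 / snd u) = fst v / snd v - fst u / snd u" .
      moreover have "aff u (kink u v) * (snd v - snd u) = cross u v"
        using uv' by (simp add: aff_def kink_def cross_def field_simps)
      ultimately show "c u v = 1/12 * ((fst v / snd v - fst u / snd u) + cross u v)"
        unfolding c_def distrib_left by simp
    qed
    then show ?thesis
      unfolding pair_sum_cmult pair_sum_add
      using pair_sum_telescope[OF ne, of "\<lambda>w. fst w / snd w"] by simp
  qed
  moreover have "(\<lambda>y::int. exp (- t * (x * h (y / x)))) summable_on UNIV" if "t > 0" "x > 0" for t x
    using slice_sum[OF assms(1,2) that nz assms(4,5)] by (auto intro: has_sum_imp_summable)
  ultimately show ?thesis using that[of "\<lambda>t. pair_sum (\<lambda>u v. H u v t) us"] by simp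
qed

section \<open>The area between two envelopes\<close>

text \<open>The piecewise linear function whose graph consists of the segments joining consecutive members of the
list, seen as points in the plane with the second coordinate as abscissa; it is minus the Legendre
transform of the envelope.\<close>

fun chain_height :: "(real \<times> real) list \<Rightarrow> real \<Rightarrow> real" where
  "chain_height (u # v # us) \<beta> =
     (if \<beta> \<le> snd v then aff v (kink u v) - \<beta> * kink u v else chain_height (v # us) \<beta>)"
| "chain_height [u] \<beta> = fst u"
| "chain_height [] \<beta> = 0"

lemma chain_from_snd_le:
  "chain_from h a us \<Longrightarrow> snd (hd us) \<le> snd (last us)"
  by (induction h a us rule: chain_from.induct) (auto split: if_splits)

lemma chain_from_eventually:
  "chain_from h a us \<Longrightarrow> \<exists>b. \<forall>s\<ge>b. h s = aff (last us) s"
  by (induction h a us rule: chain_from.induct) auto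

text \<open>A line of slope between those of \<open>u\<close> and \<open>v\<close> lies below the convex function \<open>h\<close> as soon as it does so at
the kink of \<open>u\<close> and \<open>v\<close>.\<close>

lemma below_iff_chain_height:
  assumes "chain_from h a us" "\<And>u s. u \<in> set us \<Longrightarrow> aff u s \<le> h s"
    and "snd (hd us) \<le> \<beta>" "\<beta> \<le> snd (last us)"
  shows "(\<forall>s. aff (x, \<beta>) s \<le> h s) \<longleftrightarrow> x \<le> chain_height us \<beta>"
  using assms
proof (induction h a us rule: chain_from.induct)
  case (2 h a u)
  then have \<beta>: "\<beta> = snd u" by simp
  have "h a = aff u a" using 2(1) by simp
  then have "x \<le> fst u" if "\<forall>s. aff (x, \<beta>) s \<le> h s"
    using that[rule_format, of a] by (simp add: aff_def \<beta>)
  moreover have "aff (x, \<beta>) s \<le> h s" if "x \<le> fst u" for s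
    using that 2(2)[of u s] by (simp add: aff_def \<beta>)
  ultimately show ?case by auto
next
  case (3 h a u v us)
  let ?k = "kink u v"
  have uv: "snd u < snd v" and hk: "h ?k = aff u ?k" and tail: "chain_from h ?k (v # us)"
    using 3(2) by auto
  have kk: "aff u ?k = aff v ?k" using uv by (intro aff_kink) simp
  show ?case
  proof (cases "\<beta> \<le> snd v")
    case True
    have "aff (x, \<beta>) s \<le> h s" if x: "x \<le> aff v ?k - \<beta> * ?k" for s
    proof -
      have "aff (x, \<beta>) s \<le> aff v ?k + \<beta> * (s - ?k)" using x by (simp add: aff_def algebra_simps)
      also have "\<dots> \<le> h s"
      proof (cases "s \<ge> ?k")
        case True
        then have "\<beta> * (s - ?k) \<le> snd v * (s - ?k)" using \<open>\<beta> \<le> snd v\<close> by (intro mult_right_mono) auto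
        then show ?thesis using aff_shift[of v s ?k] 3(3)[of v s] by simp
      next
        case False
        then have "\<beta> * (s - ?k) \<le> snd u * (s - ?k)" using 3(4) by (intro mult_right_mono_neg) auto
        then show ?thesis using aff_shift[of u s ?k] 3(3)[of u s] kk by simp
      qed
      finally show ?thesis .
    qed
    moreover have "x \<le> aff v ?k - \<beta> * ?k" if "\<forall>s. aff (x, \<beta>) s \<le> h s"
      using that[rule_format, of ?k] hk kk by (simp add: aff_def)
    ultimately show ?thesis using True by auto
  next
    case False
    then show ?thesis using 3(1)[OF tail] 3(3,5) by simp
  qed
qed simp

lemma has_integral_chain_height:
  assumes "chain_from h a us"
  shows "(chain_height us has_integral pair_sum (\<lambda>u v. (fst u + fst v) / 2 * (snd v - snd u)) us)
    {snd (hd us)..snd (last us)}"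
  using assms
proof (induction h a us rule: chain_from.induct)
  case (3 h a u v us)
  let ?k = "kink u v"
  have uv: "snd u < snd v" and tail: "chain_from h ?k (v # us)" using 3(2) by auto
  have kk: "aff u ?k = aff v ?k" using uv by (intro aff_kink) simp
  let ?F = "\<lambda>\<beta>. \<beta> * aff v ?k - \<beta>\<^sup>2 / 2 * ?k"
  have "((\<lambda>\<beta>. aff v ?k - \<beta> * ?k) has_integral ?F (snd v) - ?F (snd u)) {snd u..snd v}"
    using uv
    by (intro fundamental_theorem_of_calculus)
       (auto intro!: derivative_eq_intros simp: has_real_derivative_iff_has_vector_derivative[symmetric])
  moreover have F: "?F (snd v) - ?F (snd u) = (fst u + fst v) / 2 * (snd v - snd u)"
  proof -
    have k: "?k * (snd v - snd u) = fst u - fst v" using uv by (simp add: kink_def)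
    have "?F (snd v) - ?F (snd u) = (snd v - snd u) * aff v ?k - (?k * (snd v - snd u)) * (snd u + snd v) / 2"
      by (simp add: power2_eq_square algebra_simps diff_divide_distrib)
    also have "(snd v - snd u) * aff v ?k = (snd v - snd u) * fst v + snd v * (?k * (snd v - snd u))"
      by (simp add: aff_def algebra_simps)
    finally show ?thesis unfolding k by (simp add: field_simps)
  qed
  ultimately have "((\<lambda>\<beta>. aff v ?k - \<beta> * ?k) has_integral (fst u + fst v) / 2 * (snd v - snd u)) {snd u..snd v}"
    unfolding F by blast
  then have 1: "(chain_height (u # v # us) has_integral (fst u + fst v) / 2 * (snd v - snd u)) {snd u..snd v}"
    by (rule has_integral_eq[rotated]) simp
  have 2: "(chain_height (u # v # us) has_integral
      pair_sum (\<lambda>u v. (fst u + fst v) / 2 * (snd v - snd u)) (v # us)) {snd v..snd (last (v # us))}"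
    using has_integral_spike_finite[OF _ _ 3(1)[OF tail], of "{snd v}" "chain_height (u # v # us)"] by simp
  have L: "last (u # v # us) = last (v # us)" by simp
  show ?case
    unfolding L list.sel pair_sum.simps(1)
    using has_integral_combine[OF less_imp_le[OF uv] _ 1 2] chain_from_snd_le[OF tail]
    by (simp only: list.sel)
qed (auto intro: has_integral_refl)

abbreviation flip :: "real \<times> real \<Rightarrow> real \<times> real" where
  "flip w \<equiv> (- fst w, snd w)"

text \<open>When \<open>h\<close> and \<open>k\<close> are the restrictions of a support function to the vertical lines with abscissa \<open>1\<close>
and \<open>-1\<close>, these are the points of the convex set with this support function.\<close>

definition common_minorants :: "(real \<Rightarrow> real) \<Rightarrow> (real \<Rightarrow> real) \<Rightarrow> (real \<times> real) set" where
  "common_minorants h k = {w. \<forall>s. aff w s \<le> h s \<and> aff (flip w) s \<le> k s}"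

text \<open>The chord at height \<open>\<beta>\<close> runs from minus one chain height to the other, so the area is the integral
of the sum of both heights, a sum of trapezoids. Twice the area of a trapezoid is the determinant of its upper
corners plus the increment of \<open>fst * snd\<close>; these increments telescope and cancel between the chains
because the chains have mirrored end points.\<close>

lemma emeasure_common_minorants:
  assumes us: "chain_from h a us" "\<And>s. s \<le> a \<Longrightarrow> h s = aff (hd us) s" "\<And>u s. u \<in> set us \<Longrightarrow> aff u s \<le> h s"
    and vs: "chain_from k b vs" "\<And>u s. u \<in> set vs \<Longrightarrow> aff u s \<le> k s"
    and ends: "hd vs = flip (hd us)" "last vs = flip (last us)"
  shows "emeasure lborel (common_minorants h k) = ennreal ((pair_sum cross us + pair_sum cross vs) / 2)"
proof -
  define Q where "Q = common_minorants h k"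
  let ?l = "snd (hd us)" and ?r = "snd (last us)"
  define F where "F = (\<lambda>\<beta>. chain_height us \<beta> + chain_height vs \<beta>)"
  have ne: "us \<noteq> []" "vs \<noteq> []" using us(1) vs(1) by auto
  then have mem: "hd us \<in> set us" "last us \<in> set us" "hd vs \<in> set vs" "last vs \<in> set vs" by auto
  have lr: "?l \<le> ?r" using chain_from_snd_le[OF us(1)] .
  have range: "?l \<le> \<beta> \<and> \<beta> \<le> ?r" if "(x, \<beta>) \<in> Q" for x \<beta>
  proof
    have below: "aff (x, \<beta>) s \<le> h s" for s using that by (simp add: Q_def common_minorants_def)
    obtain c where c: "h s = aff (last us) s" if "s \<ge> c" for s
      using chain_from_eventually[OF us(1)] by blast
    show "\<beta> \<le> ?r"
    proof (rule ccontr)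
      assume "\<not> \<beta> \<le> ?r"
      define s where "s = max c ((fst (last us) - x) / (\<beta> - ?r) + 1)"
      have "(fst (last us) - x) / (\<beta> - ?r) < s" by (simp add: s_def less_max_iff_disj)
      then have "fst (last us) - x < s * (\<beta> - ?r)" using \<open>\<not> \<beta> \<le> ?r\<close> by (simp add: pos_divide_less_eq)
      moreover have "aff (x, \<beta>) s \<le> aff (last us) s" using below[of s] c[of s] by (simp add: s_def)
      ultimately show False by (simp add: aff_def algebra_simps)
    qed
    show "?l \<le> \<beta>"
    proof (rule ccontr)
      assume "\<not> ?l \<le> \<beta>"
      define s where "s = min a ((x - fst (hd us)) / (?l - \<beta>) - 1)"
      have "s < (x - fst (hd us)) / (?l - \<beta>)" by (simp add: s_def min_less_iff_disj)
      then have "s * (?l - \<beta>) < x - fst (hd us)" using \<open>\<not> ?l \<le> \<beta>\<close> by (simp add: pos_less_divide_eq)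
      moreover have "aff (x, \<beta>) s \<le> aff (hd us) s" using below[of s] us(2)[of s] by (simp add: s_def)
      ultimately show False by (simp add: aff_def algebra_simps)
    qed
  qed
  have inQ: "(x, \<beta>) \<in> Q \<longleftrightarrow> - chain_height vs \<beta> \<le> x \<and> x \<le> chain_height us \<beta>" if "?l \<le> \<beta>" "\<beta> \<le> ?r" for x \<beta>
    using below_iff_chain_height[OF us(1,3), of \<beta> x] below_iff_chain_height[OF vs, of \<beta> "-x"] that
    by (auto simp: Q_def common_minorants_def ends)
  \<comment> \<open>The chord is nonempty: it contains a point of the segment between the two common end points.\<close>
  have F0: "0 \<le> F \<beta>" if \<beta>: "\<beta> \<in> {?l..?r}" for \<beta>
  proof -
    obtain \<theta> where \<theta>: "0 \<le> \<theta>" "\<theta> \<le> 1" "\<beta> = (1 - \<theta>) * ?l + \<theta> * ?r"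
    proof (cases "?l = ?r")
      case True then show ?thesis using that[of 0] \<beta> by simp
    next
      case False
      then show ?thesis using that[of "(\<beta> - ?l) / (?r - ?l)"] \<beta> lr
        by (simp add: divide_simps) (simp add: algebra_simps)
    qed
    define x where "x = (1 - \<theta>) * fst (hd us) + \<theta> * fst (last us)"
    have "aff (x, \<beta>) s \<le> h s" for s
    proof -
      have "aff (x, \<beta>) s = (1 - \<theta>) * aff (hd us) s + \<theta> * aff (last us) s"
        by (simp add: x_def \<theta>(3) aff_def algebra_simps)
      also have "\<dots> \<le> (1 - \<theta>) * h s + \<theta> * h s"
        using \<theta> mem us(3) by (intro add_mono mult_left_mono) auto
      finally show ?thesis by (simp add: algebra_simps)
    qed
    moreover have "aff (- x, \<beta>) s \<le> k s" for s
    proof -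
      have "aff (- x, \<beta>) s = (1 - \<theta>) * aff (hd vs) s + \<theta> * aff (last vs) s"
        by (simp add: x_def \<theta>(3) aff_def ends algebra_simps)
      also have "\<dots> \<le> (1 - \<theta>) * k s + \<theta> * k s"
        using \<theta> mem vs(2) by (intro add_mono mult_left_mono) auto
      finally show ?thesis by (simp add: algebra_simps)
    qed
    ultimately have "(x, \<beta>) \<in> Q" by (simp add: Q_def common_minorants_def)
    then show ?thesis using inQ[of \<beta> x] \<beta> by (simp add: F_def)
  qed
  have Fint: "(F has_integral (pair_sum cross us + pair_sum cross vs) / 2) {?l..?r}"
  proof -
    have trap: "pair_sum (\<lambda>u v. (fst u + fst v) / 2 * (snd v - snd u)) ws =
        (pair_sum cross ws + (fst (last ws) * snd (last ws) - fst (hd ws) * snd (hd ws))) / 2"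
      if "ws \<noteq> []" for ws :: "(real \<times> real) list"
    proof -
      have "pair_sum (\<lambda>u v. (fst u + fst v) / 2 * (snd v - snd u)) ws =
        pair_sum (\<lambda>u v. 1/2 * (cross u v + (fst v * snd v - fst u * snd u))) ws"
        by (intro pair_sum_cong) (simp add: cross_def field_simps)
      then show ?thesis
        unfolding pair_sum_cmult pair_sum_add
        using pair_sum_telescope[OF that, of "\<lambda>w. fst w * snd w"] by simp
    qed
    show ?thesis
      using has_integral_add[OF has_integral_chain_height[OF us(1)]
          has_integral_chain_height[OF vs(1), unfolded ends snd_conv]]
      unfolding trap[OF ne(1)] trap[OF ne(2)] F_def ends by (simp add: add_divide_distrib diff_divide_distrib)
  qed
  have "closed Q"
  proof -
    have "Q = (\<Inter>s. {w. aff w s \<le> h s} \<inter> {w. aff (flip w) s \<le> k s})"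
      by (auto simp: Q_def common_minorants_def)
    moreover have "closed ({w. aff w s \<le> h s} \<inter> {w. aff (flip w) s \<le> k s})" for s
      unfolding aff_def by (intro closed_Int closed_Collect_le continuous_intros)
    ultimately show ?thesis by auto
  qed
  then have "Q \<in> sets (lborel \<Otimes>\<^sub>M lborel)" unfolding lborel_prod sets_lborel by (rule borel_closed)
  then have "emeasure (lborel \<Otimes>\<^sub>M lborel) Q = (\<integral>\<^sup>+ \<beta>. emeasure lborel ((\<lambda>x. (x, \<beta>)) -` Q) \<partial>lborel)"
    by (rule lborel_pair.emeasure_pair_measure_alt2)
  also have "\<dots> = (\<integral>\<^sup>+ \<beta>. ennreal (F \<beta>) * indicator {?l..?r} \<beta> \<partial>lborel)"
  proof (rule nn_integral_cong)
    fix \<beta> :: real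
    show "emeasure lborel ((\<lambda>x. (x, \<beta>)) -` Q) = ennreal (F \<beta>) * indicator {?l..?r} \<beta>"
    proof (cases "\<beta> \<in> {?l..?r}")
      case True
      then have "(\<lambda>x. (x, \<beta>)) -` Q = {- chain_height vs \<beta>..chain_height us \<beta>}" using inQ by auto
      then show ?thesis using F0[OF True] True by (simp add: F_def add.commute)
    next
      case False
      then have "(\<lambda>x. (x, \<beta>)) -` Q = {}" using range by fastforce
      then show ?thesis using False by simp
    qed
  qed
  also have "\<dots> = ennreal ((pair_sum cross us + pair_sum cross vs) / 2)"
    using F0 Fint by (intro nn_integral_has_integral_lebesgue') (auto simp: F_def)
  finally show ?thesis by (simp add: Q_def lborel_prod)
qed

section \<open>The lattice sum of a polygonal support function\<close>

text \<open>On the line with abscissa \<open>1\<close> this says that the vertices of the polygon in the right half plane are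
primitive lattice points \<open>(p, q)\<close> at which the support function is \<open>1\<close>: such a point lies over the
slope \<open>q/p\<close>, and by homogeneity the support function at \<open>(1, q/p)\<close> is \<open>1/p\<close>.\<close>

definition primitive_kinks :: "(real \<times> real) set \<Rightarrow> bool" where
  "primitive_kinks W \<longleftrightarrow> (\<forall>u\<in>W. \<forall>v\<in>W. \<forall>s. u \<noteq> v \<and> aff u s = envelope W s \<and> aff v s = envelope W s \<longrightarrow>
    (\<exists>p q. p > 0 \<and> coprime q (int p) \<and> s = real_of_int q / real p \<and> envelope W s = 1 / real p))"

lemma primitive_kinks_chain:
  assumes "primitive_kinks W" "chain_from (envelope W) a us" "set us \<subseteq> W" "(u, v) \<in> consecutive us"
  shows "\<exists>p q. p > 0 \<and> coprime q (int p) \<and> kink u v = real_of_int q / real p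
    \<and> envelope W (kink u v) = 1 / real p"
proof -
  have uv: "snd u < snd v" "envelope W (kink u v) = aff u (kink u v)"
    using chain_from_consecutive[OF assms(2,4)] by simp_all
  have "u \<in> W" "v \<in> W" using consecutive_subset[OF assms(4)] assms(3) by blast+
  moreover have "u \<noteq> v" "aff v (kink u v) = envelope W (kink u v)" using uv aff_kink[of u v] by auto
  ultimately show ?thesis using assms(1) uv(2) unfolding primitive_kinks_def by metis
qed

lemma pair_sum_cross_nonneg:
  assumes "primitive_kinks W" "chain_from (envelope W) a us" "set us \<subseteq> W"
  shows "pair_sum cross us \<ge> 0"
proof -
  have "cross u v \<ge> 0" if uv: "(u, v) \<in> consecutive us" for u v
  proof -
    have *: "snd u < snd v" "envelope W (kink u v) = aff u (kink u v)"
      using chain_from_consecutive[OF assms(2) uv] by simp_all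
    have "aff u (kink u v) \<ge> 0" using primitive_kinks_chain[OF assms uv] *(2) by auto
    moreover have "cross u v = aff u (kink u v) * (snd v - snd u)"
      using * by (simp add: aff_def kink_def cross_def field_simps)
    ultimately show ?thesis using *(1) by simp
  qed
  then show ?thesis by (induction us rule: induct_list012) auto
qed

definition full_chain :: "(real \<times> real) set \<Rightarrow> real \<Rightarrow> (real \<times> real) list \<Rightarrow> bool" where
  "full_chain W a us \<longleftrightarrow> chain_from (envelope W) a us \<and> (\<forall>s\<le>a. envelope W s = aff (hd us) s) \<and>
     set us \<subseteq> W \<and> (\<forall>w\<in>W. snd (hd us) \<le> snd w \<and> snd w \<le> snd (last us))"

lemma full_chainD:
  assumes "full_chain W a us"
  shows "chain_from (envelope W) a us" "\<And>s. s \<le> a \<Longrightarrow> envelope W s = aff (hd us) s"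
    "set us \<subseteq> W" "hd us \<in> W" "last us \<in> W"
    "\<And>w. w \<in> W \<Longrightarrow> snd (hd us) \<le> snd w" "\<And>w. w \<in> W \<Longrightarrow> snd w \<le> snd (last us)"
proof -
  have "us \<noteq> []" using assms by (auto simp: full_chain_def)
  then have "hd us \<in> set us" "last us \<in> set us" by simp_all
  moreover have "set us \<subseteq> W" using assms by (simp add: full_chain_def)
  ultimately show "hd us \<in> W" "last us \<in> W" by blast+
qed (use assms in \<open>simp_all add: full_chain_def\<close>)

lemma full_chain_exists:
  assumes "finite W" "inj_on snd W" "W \<noteq> {}"
  shows "\<exists>a us. full_chain W a us"
proof (rule envelope_chain[OF assms])
  fix us a
  assume "chain_from (envelope W) a us" "set us \<subseteq> W" "\<And>s. s \<le> a \<Longrightarrow> envelope W s = aff (hd us) s"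
    "\<And>w. w \<in> W \<Longrightarrow> snd (hd us) \<le> snd w" "\<And>w. w \<in> W \<Longrightarrow> snd w \<le> snd (last us)"
  then have "full_chain W a us" unfolding full_chain_def by simp
  then show ?thesis by blast
qed

lemma envelope_half_plane_sum:
  assumes chain: "full_chain W a us" and nz: "\<And>w. w \<in> W \<Longrightarrow> snd w \<noteq> 0"
    and ends: "snd (hd us) < 0" "snd (last us) > 0" and kinks: "primitive_kinks W"
  shows "\<exists>H. (\<forall>t>0. (\<forall>x>0. (\<lambda>y::int. exp (- t * (x * envelope W (y / x)))) summable_on UNIV) \<and>
      ((\<lambda>n. \<Sum>\<^sub>\<infinity>y::int. exp (- t * (real (Suc n) * envelope W (y / real (Suc n))))) has_sum H t) UNIV) \<and>
    has_const_term H ((fst (last us) / snd (last us) - fst (hd us) / snd (hd us) + pair_sum cross us) / 12)"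
proof -
  note us = full_chainD[OF chain]
  have nz': "snd u \<noteq> 0" if "u \<in> set us" for u using nz that us(3) by blast
  show ?thesis
    by (rule half_plane_sum[OF us(1,2) nz' ends primitive_kinks_chain[OF kinks us(1,3)]]) auto
qed

definition support :: "(real \<times> real) set \<Rightarrow> real \<Rightarrow> real \<Rightarrow> real" where
  "support W x y = Max ((\<lambda>w. fst w * x + snd w * y) ` W)"

lemma support_scale:
  assumes "finite W" "W \<noteq> {}" "c \<ge> 0"
  shows "support W (c * x) (c * y) = c * support W x y"
proof -
  have "mono ((*) c)" using assms(3) by (auto intro: monoI mult_left_mono)
  then have "c * support W x y = Max ((*) c ` (\<lambda>w. fst w * x + snd w * y) ` W)"
    unfolding support_def using assms by (intro mono_Max_commute) auto
  then show ?thesis by (simp add: support_def image_image algebra_simps)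
qed

lemma envelope_eq_support: "envelope W s = support W 1 s"
  by (simp add: envelope_def support_def aff_def)

lemma envelope_flip_eq_support: "envelope (flip ` W) s = support W (- 1) s"
  by (simp add: envelope_def support_def aff_def image_image)

lemma has_sum_int_split:
  fixes f :: "int \<Rightarrow> real"
  assumes "((\<lambda>n. f (int (Suc n))) has_sum a) UNIV" "((\<lambda>n. f (- int (Suc n))) has_sum b) UNIV"
  shows "(f has_sum (a + b + f 0)) UNIV"
proof -
  have "bij_betw (\<lambda>n. int (Suc n)) UNIV {1..}"
    by (rule bij_betw_byWitness[where f' = "\<lambda>y. nat (y - 1)"]) auto
  then have 1: "(f has_sum a) {1..}"
    using assms(1) has_sum_reindex_bij_betw[of "\<lambda>n. int (Suc n)" UNIV "{1..}" f] by simp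
  have "bij_betw (\<lambda>n. - int (Suc n)) UNIV {..-1}"
    by (rule bij_betw_byWitness[where f' = "\<lambda>y. nat (- y - 1)"]) auto
  then have 2: "(f has_sum b) {..-1}"
    using assms(2) has_sum_reindex_bij_betw[of "\<lambda>n. - int (Suc n)" UNIV "{..-1}" f] by simp
  have 3: "(f has_sum f 0) {0}" using has_sum_finite[of "{0}" f] by simp
  have "{1..} \<union> {..-1} \<union> {0::int} = UNIV" by auto
  moreover have "{1..} \<inter> {..-1} = ({} :: int set)" "({1..} \<union> {..-1}) \<inter> {0} = ({} :: int set)" by auto
  ultimately show ?thesis
    using has_sum_Un_disjoint[OF has_sum_Un_disjoint[OF 1 2] 3] by metis
qed

text \<open>Both half planes are governed by chains with mirrored end points, so the terms \<open>fst / snd\<close> cancel,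
and the determinants that remain add up to twice the area of the set of common minorants. The line of
abscissa \<open>0\<close> has constant term \<open>0\<close>, since the two constant terms \<open>-1/2\<close> of its half lines
occur with opposite signs.\<close>

lemma lattice_sum_const_term:
  assumes fin: "finite W" and inj: "inj_on snd W" and nz: "\<And>w. w \<in> W \<Longrightarrow> snd w \<noteq> 0"
    and neg: "w0 \<in> W" "snd w0 < 0" and pos: "w1 \<in> W" "snd w1 > 0"
    and kinks: "\<forall>u\<in>W. \<forall>v\<in>W. \<forall>x y. u \<noteq> v \<and> x \<noteq> 0 \<and>
      fst u * x + snd u * y = support W x y \<and> fst v * x + snd v * y = support W x y \<longrightarrow>
      (\<exists>p q c. coprime p q \<and> c > 0 \<and> x = c * real_of_int p \<and> y = c * real_of_int q \<and> support W p q = 1)"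
  shows "\<exists>H. (\<forall>t>0. ((\<lambda>(x, y). exp (- t * support W (real_of_int x) (real_of_int y))) has_sum H t) UNIV) \<and>
    has_const_term H (measure lborel (common_minorants (envelope W) (envelope (flip ` W))) / 6)"
proof -
  have ne: "W \<noteq> {}" using pos by auto
  note scale = support_scale[OF fin ne]
  let ?V = "flip ` W"
  have injV: "inj_on snd ?V" using inj by (auto simp: inj_on_def)
  have kR: "primitive_kinks W"
    unfolding primitive_kinks_def
  proof (intro ballI allI impI, elim conjE)
    fix u v s assume uv: "u \<in> W" "v \<in> W" "u \<noteq> v" "aff u s = envelope W s" "aff v s = envelope W s"
    obtain p q c where pq: "coprime p q" "c > 0" "1 = c * real_of_int p" "s = c * real_of_int q" "support W p q = 1"
      using kinks[rule_format, of u v 1 s] uv unfolding envelope_eq_support aff_def by auto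
    have p: "p > 0" using pq(2) zero_less_mult_pos[of c "real_of_int p"] pq(3)[symmetric] by simp
    have c: "c = 1 / real_of_int p" using pq(3) p by (simp add: field_simps)
    have "envelope W s = c * support W p q" using scale[of c p q] pq by (simp add: envelope_eq_support)
    then show "\<exists>p q. p > 0 \<and> coprime q (int p) \<and> s = real_of_int q / real p \<and> envelope W s = 1 / real p"
      using p pq c by (intro exI[of _ "nat p"] exI[of _ q]) (auto simp: coprime_commute)
  qed
  have kL: "primitive_kinks ?V"
    unfolding primitive_kinks_def
  proof (intro ballI allI impI, elim conjE)
    fix u v s assume uv: "u \<in> ?V" "v \<in> ?V" "u \<noteq> v" "aff u s = envelope ?V s" "aff v s = envelope ?V s"
    have flips: "flip u \<in> W" "flip v \<in> W" "flip u \<noteq> flip v" using uv(1-3) by auto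
    obtain p q c where pq: "coprime p q" "c > 0" "- 1 = c * real_of_int p" "s = c * real_of_int q" "support W p q = 1"
      using kinks[rule_format, of "flip u" "flip v" "- 1" s] flips uv(4,5) unfolding envelope_flip_eq_support aff_def by auto
    have "c * real_of_int (- p) = 1" using pq(3) by simp
    then have p: "- p > 0" using pq(2) zero_less_mult_pos[of c "real_of_int (- p)"] by simp
    have c: "c = 1 / real_of_int (- p)" using \<open>c * real_of_int (- p) = 1\<close> p by (simp add: field_simps)
    have "envelope ?V s = c * support W p q" using scale[of c p q] pq by (simp add: envelope_flip_eq_support)
    then show "\<exists>p q. p > 0 \<and> coprime q (int p) \<and> s = real_of_int q / real p \<and> envelope ?V s = 1 / real p"
      using p pq c by (intro exI[of _ "nat (- p)"] exI[of _ q]) (auto simp: coprime_commute)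
  qed
  obtain a us where us': "full_chain W a us" using full_chain_exists[OF fin inj ne] by blast
  note us = full_chainD[OF us']
  obtain b vs where vs': "full_chain ?V b vs"
    using full_chain_exists[OF finite_imageI[OF fin] injV] ne by blast
  note vs = full_chainD[OF vs']
  have hd: "hd vs = flip (hd us)"
  proof (rule inj_onD[OF injV])
    have "flip (hd us) \<in> ?V" using us(4) by simp
    moreover obtain w where "w \<in> W" "hd vs = flip w" using vs(4) by auto
    ultimately show "snd (hd vs) = snd (flip (hd us))"
      using us(6)[of w] vs(6)[of "flip (hd us)"] by simp
  qed (use us(4) vs(4) in simp_all)
  have last: "last vs = flip (last us)"
  proof (rule inj_onD[OF injV])
    have "flip (last us) \<in> ?V" using us(5) by simp
    moreover obtain w where "w \<in> W" "last vs = flip w" using vs(5) by auto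
    ultimately show "snd (last vs) = snd (flip (last us))"
      using us(7)[of w] vs(7)[of "flip (last us)"] by simp
  qed (use us(5) vs(5) in simp_all)
  let ?l = "snd (hd us)" and ?r = "snd (last us)"
  have lr: "?l < 0" "?r > 0" using us(6)[OF neg(1)] us(7)[OF pos(1)] neg pos by linarith+
  obtain H where R: "\<And>t x. t > 0 \<Longrightarrow> x > 0 \<Longrightarrow> (\<lambda>y::int. exp (- t * (x * envelope W (y / x)))) summable_on UNIV"
    "\<And>t. t > 0 \<Longrightarrow>
      ((\<lambda>n. \<Sum>\<^sub>\<infinity>y::int. exp (- t * (real (Suc n) * envelope W (y / real (Suc n))))) has_sum H t) UNIV"
    "has_const_term H ((fst (last us) / ?r - fst (hd us) / ?l + pair_sum cross us) / 12)"
    using envelope_half_plane_sum[OF us' nz lr kR] by auto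
  have nzV: "snd w \<noteq> 0" if "w \<in> ?V" for w using nz that by auto
  have lrV: "snd (hd vs) < 0" "snd (last vs) > 0" using lr by (simp_all add: hd last)
  obtain K where L: "\<And>t x. t > 0 \<Longrightarrow> x > 0 \<Longrightarrow> (\<lambda>y::int. exp (- t * (x * envelope ?V (y / x)))) summable_on UNIV"
    "\<And>t. t > 0 \<Longrightarrow>
      ((\<lambda>n. \<Sum>\<^sub>\<infinity>y::int. exp (- t * (real (Suc n) * envelope ?V (y / real (Suc n))))) has_sum K t) UNIV"
    "has_const_term K ((fst (last vs) / snd (last vs) - fst (hd vs) / snd (hd vs) + pair_sum cross vs) / 12)"
    using envelope_half_plane_sum[OF vs' nzV lrV kL] by auto
  define G where "G = (\<lambda>t. H t + K t + (todd (t * ?r) 0 - todd (t * ?l) 0))"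
  have const: "has_const_term G (measure lborel (common_minorants (envelope W) (envelope ?V)) / 6)"
  proof -
    have "emeasure lborel (common_minorants (envelope W) (envelope ?V)) = ennreal ((pair_sum cross us + pair_sum cross vs) / 2)"
    proof (rule emeasure_common_minorants[OF us(1,2) _ vs(1) _ hd last])
      show "aff u s \<le> envelope W s" if "u \<in> set us" for u s
        using aff_le_envelope[OF fin] that us(3) by blast
      show "aff u s \<le> envelope ?V s" if "u \<in> set vs" for u s
        using aff_le_envelope[of ?V u s] fin that vs(3) by blast
    qed
    moreover have "pair_sum cross us + pair_sum cross vs \<ge> 0"
      using pair_sum_cross_nonneg[OF kR us(1,3)] pair_sum_cross_nonneg[OF kL vs(1,3)] by simp
    ultimately have m: "measure lborel (common_minorants (envelope W) (envelope ?V)) = (pair_sum cross us + pair_sum cross vs) / 2"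
      by (simp add: measure_def)
    have "has_const_term G ((fst (last us) / ?r - fst (hd us) / ?l + pair_sum cross us) / 12
      + (- fst (last us) / ?r + fst (hd us) / ?l + pair_sum cross vs) / 12 + ((0 - 1/2) - (0 - 1/2)))"
      unfolding G_def using R(3) L(3) lr unfolding hd last
      by (intro has_const_term_add has_const_term_diff has_const_term_todd) auto
    moreover have "((fst (last us) / ?r - fst (hd us) / ?l + pair_sum cross us) / 12
      + (- fst (last us) / ?r + fst (hd us) / ?l + pair_sum cross vs) / 12 + ((0 - 1/2) - (0 - 1/2)))
      = measure lborel (common_minorants (envelope W) (envelope ?V)) / 6"
      unfolding m by (simp add: field_simps)
    ultimately show ?thesis by (simp only:)
  qed
  have sums: "((\<lambda>(x, y). exp (- t * support W (real_of_int x) (real_of_int y))) has_sum G t) UNIV" if t: "t > 0" for t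
  proof -
    define f where "f = (\<lambda>(x::int) (y::int). exp (- t * support W (real_of_int x) (real_of_int y)))"
    have fR: "f x = (\<lambda>y::int. exp (- t * (x * envelope W (y / x))))" if "x > 0" for x
      using that scale[of x 1 "_ / x"] by (auto simp: f_def envelope_eq_support)
    have fL: "f x = (\<lambda>y::int. exp (- t * (real_of_int (- x) * envelope ?V (y / real_of_int (- x)))))" if "x < 0" for x
      using that scale[of "real_of_int (- x)" "- 1" "_ / real_of_int (- x)"] by (auto simp: f_def envelope_flip_eq_support)
    have s0: "support W 0 y = (if y \<le> 0 then ?l * y else ?r * y)" for y
      unfolding support_def
    proof (rule Max_eqI)
      show "z \<le> (if y \<le> 0 then ?l * y else ?r * y)" if "z \<in> (\<lambda>w. fst w * 0 + snd w * y) ` W" for z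
        using that us(6,7) by (auto intro: mult_right_mono mult_right_mono_neg)
    qed (use fin us(4,5) in \<open>auto split: if_splits\<close>)
    have f0: "(f 0 has_sum (todd (t * ?r) 0 - todd (t * ?l) 0)) UNIV"
    proof -
      have "((\<lambda>y::int. exp (0 - (t * ?l) * y)) has_sum - todd (t * ?l) 0) {..0}"
        using exp_sums_below[of "t * ?l" 0 0] lr t by (simp add: todd_def mult_pos_neg)
      then have 1: "(f 0 has_sum - todd (t * ?l) 0) {..0}"
        by (rule has_sum_eqI[rotated]) (simp add: f_def s0)
      have "((\<lambda>y::int. exp (0 - (t * ?r) * y)) has_sum todd (t * ?r) 0) {0<..}"
        using exp_sums_above[of "t * ?r" 0 0] lr t by (simp add: todd_def)
      then have 2: "(f 0 has_sum todd (t * ?r) 0) {0<..}"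
        by (rule has_sum_eqI[rotated]) (simp add: f_def s0)
      have U: "{..0} \<union> {0<..} = (UNIV :: int set)" "{..0} \<inter> {0<..} = ({} :: int set)" by auto
      show ?thesis using has_sum_Un_disjoint[OF 1 2 U(2)] U(1) by simp
    qed
    have slice: "(f x has_sum infsum (f x) UNIV) UNIV" for x
    proof -
      consider "x > 0" | "x = 0" | "x < 0" by linarith
      then have "f x summable_on UNIV"
      proof cases
        case 1 then show ?thesis using R(1)[OF t, of x] fR by simp
      next
        case 2 then show ?thesis using f0 by (auto intro: has_sum_imp_summable)
      next
        case 3 then show ?thesis using L(1)[OF t, of "real_of_int (- x)"] fL by simp
      qed
      then show ?thesis by simp
    qed
    have "((\<lambda>n. infsum (f (int (Suc n))) UNIV) has_sum H t) UNIV"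
      using R(2)[OF t] fR[of "int (Suc _)"] by simp
    moreover have "((\<lambda>n. infsum (f (- int (Suc n))) UNIV) has_sum K t) UNIV"
    proof -
      have "f (- int (Suc n)) = (\<lambda>y::int. exp (- t * (real (Suc n) * envelope ?V (y / real (Suc n)))))" for n
        using fL[of "- int (Suc n)"] by (simp only: minus_minus of_int_of_nat_eq)
      then show ?thesis using L(2)[OF t] by (simp only:)
    qed
    ultimately have outer: "((\<lambda>x. infsum (f x) UNIV) has_sum G t) UNIV"
      using has_sum_int_split[of "\<lambda>x. infsum (f x) UNIV"] infsumI[OF f0] by (simp add: G_def)
    have "(\<lambda>(x, y). f x y) summable_on (SIGMA x:UNIV. UNIV)"
      by (rule summable_on_SigmaI[where g = "\<lambda>x. infsum (f x) UNIV"])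
         (use slice outer in \<open>auto simp: f_def intro: has_sum_imp_summable\<close>)
    then have "((\<lambda>(x, y). f x y) has_sum G t) (SIGMA x:UNIV. UNIV)"
      using slice outer by (intro has_sum_SigmaI[where g = "\<lambda>x. infsum (f x) UNIV"]) auto
    then show ?thesis by (simp add: f_def)
  qed
  show ?thesis using sums const by blast
qed

lemma support_add:
  assumes "finite W" "W \<noteq> {}"
  shows "support W (x + x') (y + y') \<le> support W x y + support W x' y'"
proof -
  have "fst w * (x + x') + snd w * (y + y') \<le> support W x y + support W x' y'" if "w \<in> W" for w
  proof -
    have "fst w * x + snd w * y \<le> support W x y" "fst w * x' + snd w * y' \<le> support W x' y'"
      unfolding support_def using assms that by auto
    then show ?thesis by (simp add: algebra_simps)
  qed
  then show ?thesis unfolding support_def[of W "x + x'" "y + y'"] using assms by auto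
qed

text \<open>Homogeneity reduces every vertical line except the one through the origin to the abscissae \<open>1\<close>
and \<open>-1\<close>. On the exceptional line, a violation would be scaled by an arbitrarily large factor \<open>r\<close>,
and subadditivity would carry it over to the line of abscissa \<open>1\<close>.\<close>

lemma common_minorants_iff:
  assumes W: "finite W" "W \<noteq> {}"
  shows "w \<in> common_minorants (envelope W) (envelope (flip ` W)) \<longleftrightarrow>
    (\<forall>x y. fst w * x + snd w * y \<le> support W x y)" (is "?L \<longleftrightarrow> ?R")
proof -
  have L: "?L \<longleftrightarrow> (\<forall>s. fst w + snd w * s \<le> support W 1 s \<and> - fst w + snd w * s \<le> support W (- 1) s)"
    unfolding common_minorants_def envelope_flip_eq_support unfolding envelope_eq_support aff_def by simp
  show ?thesis
    unfolding L
  proof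
    assume R: ?R
    show "\<forall>s. fst w + snd w * s \<le> support W 1 s \<and> - fst w + snd w * s \<le> support W (- 1) s"
    proof
      fix s
      show "fst w + snd w * s \<le> support W 1 s \<and> - fst w + snd w * s \<le> support W (- 1) s"
        using R[rule_format, of 1 s] R[rule_format, of "- 1" s] by simp
    qed
  next
    assume "\<forall>s. fst w + snd w * s \<le> support W 1 s \<and> - fst w + snd w * s \<le> support W (- 1) s"
    then have right: "fst w + snd w * s \<le> support W 1 s" and left: "- fst w + snd w * s \<le> support W (- 1) s" for s
      by simp_all
    show ?R
    proof (intro allI)
      fix x y :: real
      consider "x > 0" | "x < 0" | "x = 0" by linarith
      then show "fst w * x + snd w * y \<le> support W x y"
      proof cases
        case 1
        have "x * (fst w + snd w * (y / x)) \<le> x * support W 1 (y / x)"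
          using right[of "y / x"] 1 by (intro mult_left_mono) auto
        also have "\<dots> = support W x y" using support_scale[OF W, of x 1 "y / x"] 1 by simp
        finally show ?thesis using 1 by (simp add: algebra_simps)
      next
        case 2
        have "- x * (- fst w + snd w * (y / - x)) \<le> - x * support W (- 1) (y / - x)"
          using left[of "y / - x"] 2 by (intro mult_left_mono) auto
        also have "\<dots> = support W x y" using support_scale[OF W, of "- x" "- 1" "y / - x"] 2 by simp
        finally show ?thesis using 2 by (simp add: algebra_simps)
      next
        case 3
        show ?thesis
        proof (rule ccontr)
          assume neg: "\<not> ?thesis"
          define D where "D = snd w * y - support W 0 y"
          have D: "D > 0" using neg 3 by (simp add: D_def)
          define r where "r = (\<bar>support W 1 0 - fst w\<bar> + 1) / D"
          have r: "r > 0" "r * D = \<bar>support W 1 0 - fst w\<bar> + 1" using D by (simp_all add: r_def)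
          have "fst w + snd w * (r * y) \<le> support W (1 + 0) (0 + r * y)" using right[of "r * y"] by simp
          also have "\<dots> \<le> support W 1 0 + support W 0 (r * y)" by (rule support_add[OF W])
          also have "support W 0 (r * y) = r * support W 0 y" using support_scale[OF W, of r 0 y] r by simp
          finally have "r * D \<le> support W 1 0 - fst w" by (simp add: D_def algebra_simps)
          then show False using r(2) by linarith
        qed
      qed
    qed
  qed
qed

section \<open>Facet normals of Fano polygons\<close>

text \<open>Cramer's rule for the vector \<open>x\<close> with prescribed pairings with \<open>v\<close> and \<open>w\<close>.\<close>

lemma cramer_unit:
  fixes v w x :: "real^2"
  assumes "x \<bullet> v = 1" "x \<bullet> w = 1"
  shows "(v $ 1 * w $ 2 - v $ 2 * w $ 1) * x $ 1 = w $ 2 - v $ 2"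
    "(v $ 1 * w $ 2 - v $ 2 * w $ 1) * x $ 2 = v $ 1 - w $ 1"
proof -
  let ?d = "v $ 1 * w $ 2 - v $ 2 * w $ 1"
  have e: "x $ 1 * v $ 1 + x $ 2 * v $ 2 = 1" "x $ 1 * w $ 1 + x $ 2 * w $ 2 = 1"
    using assms by (simp_all add: inner_vec_def sum_2)
  have "?d * x $ 1 = (x $ 1 * v $ 1 + x $ 2 * v $ 2) * w $ 2 - (x $ 1 * w $ 1 + x $ 2 * w $ 2) * v $ 2"
    by (simp add: algebra_simps)
  then show "?d * x $ 1 = w $ 2 - v $ 2" using e by simp
  have "?d * x $ 2 = (x $ 1 * w $ 1 + x $ 2 * w $ 2) * v $ 1 - (x $ 1 * v $ 1 + x $ 2 * v $ 2) * w $ 1"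
    by (simp add: algebra_simps)
  then show "?d * x $ 2 = v $ 1 - w $ 1" using e by simp
qed

lemma unit_functionals_independent:
  fixes v w x :: "real^2"
  assumes "x \<bullet> v = 1" "x \<bullet> w = 1" "v \<noteq> w"
  shows "v $ 1 * w $ 2 - v $ 2 * w $ 1 \<noteq> 0"
  using cramer_unit[OF assms(1,2)] assms(3) by (auto simp: vec_eq_iff forall_2)

lemma unit_functionals_determine:
  fixes v w x y :: "real^2"
  assumes "x \<bullet> v = 1" "x \<bullet> w = 1" "v \<noteq> w" "y \<bullet> v = 1" "y \<bullet> w = 1"
  shows "x = y"
proof -
  have "x $ 1 = y $ 1" "x $ 2 = y $ 2"
    using cramer_unit[OF assms(1,2)] cramer_unit[OF assms(4,5)] unit_functionals_independent[OF assms(1-3)]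
      mult_left_cancel by metis+
  then show ?thesis by (simp add: vec_eq_iff forall_2)
qed

text \<open>A facet contains two distinct lattice points, which are linearly independent because they lie on a line
that avoids the origin. Cramer's rule therefore gives both the rationality and the uniqueness of
the normal.\<close>

lemma facet_normal_props:
  assumes P: "fano_polytope P" and F: "F facet_of P"
  shows "P \<subseteq> {x. facet_normal P F \<bullet> x \<le> 1}" "F = P \<inter> {x. facet_normal P F \<bullet> x = 1}"
proof -
  obtain S where S: "finite S" "S \<subseteq> lattice_points" "P = convex hull S"
    using P by (auto simp: fano_polytope_def lattice_polytope_def)
  have P0: "0 \<in> interior P" and dim: "aff_dim P = 2" using P by (auto simp: fano_polytope_def)
  have poly: "polyhedron P" using S polytope_convex_hull[of S] polytope_imp_polyhedron by (metis polytope_def)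
  obtain a b where ab: "a \<noteq> 0" "P \<subseteq> {x. a \<bullet> x \<le> b}" "F = P \<inter> {x. a \<bullet> x = b}"
    using facet_of_polyhedron[OF poly F] by blast
  have b: "b > 0"
  proof -
    obtain e where e: "e > 0" "ball 0 e \<subseteq> P" using P0 by (meson mem_interior)
    define x where "x = (e / 2 / norm a) *\<^sub>R a"
    have "norm x < e" using e ab(1) by (simp add: x_def)
    then have "x \<in> P" using e(2) by auto
    then have "a \<bullet> x \<le> b" using ab(2) by auto
    moreover have "a \<bullet> x > 0" using e ab(1) by (simp add: x_def)
    ultimately show ?thesis by linarith
  qed
  define u where "u = (1 / b) *\<^sub>R a"
  have u: "P \<subseteq> {x. u \<bullet> x \<le> 1}" "F = P \<inter> {x. u \<bullet> x = 1}"
    using ab b by (auto simp: u_def field_simps)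
  have face: "F face_of P" and dimF: "aff_dim F = 1" using F dim by (auto simp: facet_of_def)
  obtain S' where S': "S' \<subseteq> S" "F = convex hull S'"
    using face_of_convex_hull_subset[of S F] finite_imp_compact[OF S(1)] face S(3) by blast
  have "\<exists>v w. v \<in> S' \<and> w \<in> S' \<and> v \<noteq> w"
  proof (rule ccontr)
    assume "\<not> ?thesis"
    then have "S' = {} \<or> (\<exists>v. S' = {v})" by blast
    then have "aff_dim F \<le> 0" using S'(2) by auto
    then show False using dimF by simp
  qed
  then obtain v w where vw: "v \<in> S'" "w \<in> S'" "v \<noteq> w" by blast
  have vw1: "u \<bullet> v = 1" "u \<bullet> w = 1"
    using vw(1,2) S'(2) u(2) hull_inc[of _ S' convex] by blast+
  define d where "d = v $ 1 * w $ 2 - v $ 2 * w $ 1"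
  have d: "d \<noteq> 0" using unit_functionals_independent[OF vw1 vw(3)] by (simp add: d_def)
  have "v \<in> lattice_points" "w \<in> lattice_points" using vw S' S by auto
  then have int: "v $ i \<in> \<rat>" "w $ i \<in> \<rat>" for i
    unfolding lattice_points_def using Ints_subset_Rats by auto
  have "u $ 1 = (w $ 2 - v $ 2) / d" "u $ 2 = (v $ 1 - w $ 1) / d"
    using cramer_unit[OF vw1, folded d_def] d by (simp_all add: nonzero_eq_divide_eq mult.commute)
  moreover have "d \<in> \<rat>" unfolding d_def by (intro Rats_diff Rats_mult int)
  ultimately have rat: "u \<in> rational_points"
    unfolding rational_points_def by (auto simp: forall_2 intro!: Rats_divide Rats_diff int)
  have "facet_normal P F = u"
    unfolding facet_normal_def
  proof (rule the_equality)
    show "u \<in> rational_points \<and> P \<subseteq> {x. u \<bullet> x \<le> 1} \<and> F = P \<inter> {x. u \<bullet> x = 1}" using rat u by blast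
    fix u' assume u': "u' \<in> rational_points \<and> P \<subseteq> {x. u' \<bullet> x \<le> 1} \<and> F = P \<inter> {x. u' \<bullet> x = 1}"
    have "u' \<bullet> v = 1" "u' \<bullet> w = 1"
      using u' vw(1,2) S'(2) hull_inc[of _ S' convex] by blast+
    then show "u' = u" using unit_functionals_determine vw1 vw(3) by blast
  qed
  with u show "P \<subseteq> {x. facet_normal P F \<bullet> x \<le> 1}" "F = P \<inter> {x. facet_normal P F \<bullet> x = 1}" by simp_all
qed

definition facet_normals :: "(real^2) set \<Rightarrow> (real^2) set" where
  "facet_normals P = facet_normal P ` {F. F facet_of P}"

lemma newton_function_eq_Max: "newton_function P v = Max ((\<lambda>u. u \<bullet> v) ` facet_normals P)"
  unfolding newton_function_def facet_normals_def image_image ..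

text \<open>A segment from the origin to a point outside \<open>P\<close> leaves \<open>P\<close> through a facet, and the normal of this facet
exceeds \<open>1\<close> at the outer end.\<close>

lemma fano_polytope_facet_normals:
  assumes P: "fano_polytope P"
  shows "finite (facet_normals P)" "facet_normals P \<noteq> {}" "0 \<notin> facet_normals P"
    "P = {x. \<forall>u\<in>facet_normals P. u \<bullet> x \<le> 1}"
proof -
  let ?U = "facet_normals P"
  obtain S where S: "finite S" "P = convex hull S"
    using P by (auto simp: fano_polytope_def lattice_polytope_def)
  have P0: "0 \<in> interior P" and dim: "aff_dim P = 2" using P by (auto simp: fano_polytope_def)
  have polyt: "polytope P" using S by (auto simp: polytope_def)
  have poly: "polyhedron P" using polytope_imp_polyhedron[OF polyt] .
  have fin: "finite ?U" unfolding facet_normals_def using finite_polytope_facets[OF polyt] by simp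
  have sub: "P \<subseteq> {x. \<forall>u\<in>?U. u \<bullet> x \<le> 1}"
    using facet_normal_props(1)[OF P] by (auto simp: facet_normals_def)
  have exit: "\<exists>u\<in>?U. u \<bullet> x > 1" if "x \<notin> P" for x
  proof -
    have "closed_segment 0 x \<inter> frontier P \<noteq> {}"
      using that P0 interior_subset[of P] by (intro connected_Int_frontier) auto
    then obtain y where y: "y \<in> closed_segment 0 x" "y \<in> frontier P" by blast
    have "interior P \<noteq> {}" using P0 by blast
    then have "rel_frontier P = frontier P"
      by (simp add: rel_frontier_frontier affine_hull_nonempty_interior)
    moreover have "rel_frontier P = \<Union> {F. F facet_of P}" using rel_frontier_of_polyhedron[OF poly] .
    ultimately obtain F where F: "F facet_of P" "y \<in> F" using y(2) by blast
    let ?u = "facet_normal P F"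
    have uy: "?u \<bullet> y = 1" "y \<in> P" using F facet_normal_props(2)[OF P F(1)] by blast+
    obtain c where c: "0 \<le> c" "c \<le> 1" "y = c *\<^sub>R x" using y(1) by (auto simp: closed_segment_def)
    have "c \<noteq> 1" using c(3) uy(2) that by auto
    have "c * (?u \<bullet> x) = 1" using uy(1) c(3) by simp
    then have "c > 0" "?u \<bullet> x = 1 / c" using c(1) by (cases "c = 0"; simp add: field_simps)+
    then have "?u \<bullet> x > 1" using c \<open>c \<noteq> 1\<close> by simp
    then show ?thesis using F(1) by (auto simp: facet_normals_def)
  qed
  then have eq: "P = {x. \<forall>u\<in>?U. u \<bullet> x \<le> 1}" using sub by fastforce
  have "bounded P" using polytope_imp_bounded[OF polyt] .
  then have "P \<noteq> UNIV" using not_bounded_UNIV by auto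
  then have ne: "?U \<noteq> {}" using exit by blast
  have "0 \<notin> ?U"
  proof
    assume "0 \<in> ?U"
    then obtain F where F: "F facet_of P" "facet_normal P F = 0" by (auto simp: facet_normals_def)
    then obtain y where "y \<in> F" by (auto simp: facet_of_def)
    then show False using facet_normal_props(2)[OF P F(1)] F(2) by auto
  qed
  with fin ne eq show "finite ?U" "?U \<noteq> {}" "0 \<notin> ?U" "P = {x. \<forall>u\<in>?U. u \<bullet> x \<le> 1}" by blast+
qed

text \<open>Two different facet normals with value \<open>1\<close> are linearly independent, so they determine the point \<open>x\<close>.
Any segment in \<open>P\<close> through \<open>x\<close> would lie on both facets; hence \<open>x\<close> is extreme.\<close>

lemma fano_polytope_vertex:
  assumes P: "fano_polytope P" and eq: "P = {x. \<forall>u\<in>U. u \<bullet> x \<le> 1}"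
    and uv: "u \<in> U" "u' \<in> U" "u \<noteq> u'" and x: "u \<bullet> x = 1" "u' \<bullet> x = 1" "x \<in> P"
  shows "primitive x"
proof -
  have "x extreme_point_of P"
    unfolding extreme_point_of_def
  proof (intro conjI ballI notI)
    fix a b assume ab: "a \<in> P" "b \<in> P" "x \<in> open_segment a b"
    then obtain t where t: "0 < t" "t < 1" "x = (1 - t) *\<^sub>R a + t *\<^sub>R b" "a \<noteq> b"
      by (auto simp: in_segment)
    have "w \<bullet> a = 1 \<and> w \<bullet> b = 1" if w: "w \<in> U" "w \<bullet> x = 1" for w
    proof -
      have le: "w \<bullet> a \<le> 1" "w \<bullet> b \<le> 1" using ab(1,2) w(1) eq by auto
      have sum: "(1 - t) * (1 - w \<bullet> a) + t * (1 - w \<bullet> b) = 0"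
        using w(2) t(3) by (simp add: inner_add_right algebra_simps)
      have "(1 - t) * (1 - w \<bullet> a) \<ge> 0" "t * (1 - w \<bullet> b) \<ge> 0" using t le by simp_all
      with sum have "(1 - t) * (1 - w \<bullet> a) = 0" "t * (1 - w \<bullet> b) = 0" by linarith+
      then show ?thesis using t by simp
    qed
    then have "a \<bullet> u = 1" "a \<bullet> u' = 1" "b \<bullet> u = 1" "b \<bullet> u' = 1"
      using uv(1,2) x(1,2) by (simp_all only: inner_commute[of a] inner_commute[of b])
    then have "a = b" using unit_functionals_determine uv(3) by blast
    with t show False by simp
  qed (use x in simp)
  then show ?thesis using P by (simp add: fano_polytope_def)
qed

section \<open>Sheared coordinates\<close>

text \<open>The lattice basis is \<open>(1, 0)\<close>, \<open>(k, 1)\<close>: \<open>lattice_vec\<close> takes coordinates to vectors, \<open>dual_coords\<close>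
pairs a functional with the two basis vectors, and \<open>dual_vec\<close> recovers the functional from these pairings.\<close>

definition lattice_vec :: "int \<Rightarrow> real \<Rightarrow> real \<Rightarrow> real^2" where
  "lattice_vec k x y = vector [x + real_of_int k * y, y]"

definition dual_coords :: "int \<Rightarrow> real^2 \<Rightarrow> real \<times> real" where
  "dual_coords k u = (u $ 1, real_of_int k * u $ 1 + u $ 2)"

definition dual_vec :: "int \<Rightarrow> real \<times> real \<Rightarrow> real^2" where
  "dual_vec k w = fst w *\<^sub>R axis 1 1 + (snd w - real_of_int k * fst w) *\<^sub>R axis 2 1"

lemma dual_vec_nth [simp]: "dual_vec k w $ 1 = fst w" "dual_vec k w $ 2 = snd w - real_of_int k * fst w"
  by (simp_all add: dual_vec_def axis_def)

lemma dual_coords_dual_vec [simp]: "dual_coords k (dual_vec k w) = w"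
  by (simp add: dual_coords_def)

lemma lattice_vec_nth [simp]: "lattice_vec k x y $ 1 = x + real_of_int k * y" "lattice_vec k x y $ 2 = y"
  by (simp_all add: lattice_vec_def)

lemma inner_lattice_vec: "u \<bullet> lattice_vec k x y = fst (dual_coords k u) * x + snd (dual_coords k u) * y"
  by (simp add: inner_vec_def sum_2 dual_coords_def algebra_simps)

lemma lattice_vec_coords: "lattice_vec k (v $ 1 - real_of_int k * v $ 2) (v $ 2) = v"
  by (simp add: vec_eq_iff forall_2)

text \<open>Each nonzero vector excludes at most one \<open>k\<close>.\<close>

lemma generic_shear:
  fixes A :: "(real^2) set"
  assumes "finite A" "0 \<notin> A"
  obtains k :: int where "\<And>d. d \<in> A \<Longrightarrow> snd (dual_coords k d) \<noteq> 0"
proof -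
  have "finite {k::int. real_of_int k * d $ 1 + d $ 2 = 0}" if "d \<in> A" for d
  proof (cases "d $ 1 = 0")
    case True
    have "d \<noteq> 0" using that assms(2) by blast
    then have "d $ 2 \<noteq> 0" using True by (simp add: vec_eq_iff forall_2)
    then show ?thesis using True by simp
  next
    case False
    have "k = \<lfloor>- d $ 2 / d $ 1\<rfloor>" if "real_of_int k * d $ 1 + d $ 2 = 0" for k :: int
    proof -
      have "real_of_int k = - d $ 2 / d $ 1" using that False by (simp add: field_simps)
      then show ?thesis by (metis floor_of_int)
    qed
    then have "{k::int. real_of_int k * d $ 1 + d $ 2 = 0} \<subseteq> {\<lfloor>- d $ 2 / d $ 1\<rfloor>}" by blast
    then show ?thesis by (rule finite_subset) simp
  qed
  then have "finite (\<Union>d\<in>A. {k::int. real_of_int k * d $ 1 + d $ 2 = 0})" using assms(1) by blast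
  from ex_new_if_finite[OF infinite_UNIV_int this]
  obtain k where k: "k \<notin> (\<Union>d\<in>A. {k::int. real_of_int k * d $ 1 + d $ 2 = 0})" ..
  show ?thesis
  proof (rule that)
    show "snd (dual_coords k d) \<noteq> 0" if "d \<in> A" for d
      using k that unfolding dual_coords_def by simp
  qed
qed

lemma bij_betw_lattice_vec: "bij_betw (\<lambda>(x::int, y::int). lattice_vec k x y) UNIV lattice_points"
  unfolding bij_betw_def
proof
  show "inj (\<lambda>(x::int, y::int). lattice_vec k x y)"
  proof (rule injI, clarify)
    fix x y x' y' :: int
    assume "lattice_vec k x y = lattice_vec k x' y'"
    then have "real_of_int x + real_of_int k * real_of_int y = real_of_int x' + real_of_int k * real_of_int y'"
      "real_of_int y = real_of_int y'"
      by (metis lattice_vec_nth(1), metis lattice_vec_nth(2))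
    then show "x = x' \<and> y = y'" by simp
  qed
  show "range (\<lambda>(x::int, y::int). lattice_vec k x y) = lattice_points"
  proof
    show "range (\<lambda>(x::int, y::int). lattice_vec k x y) \<subseteq> lattice_points"
      by (auto simp: lattice_points_def forall_2)
    show "lattice_points \<subseteq> range (\<lambda>(x::int, y::int). lattice_vec k x y)"
    proof
      fix v assume "v \<in> lattice_points"
      then have "v $ 1 \<in> \<int>" "v $ 2 \<in> \<int>" by (auto simp: lattice_points_def)
      then obtain a b where ab: "v $ 1 = real_of_int a" "v $ 2 = real_of_int b" by (auto elim!: Ints_cases)
      have "v = lattice_vec k (real_of_int (a - k * b)) (real_of_int b)"
        by (simp add: vec_eq_iff forall_2 ab)
      then show "v \<in> range (\<lambda>(x::int, y::int). lattice_vec k x y)"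
        by (intro range_eqI[where x = "(a - k * b, b)"]) simp
    qed
  qed
qed

lemma primitive_coprime:
  assumes "primitive (lattice_vec k (real_of_int p) (real_of_int q))"
  shows "coprime p q"
proof -
  obtain p' q' where pq: "p = gcd p q * p'" "q = gcd p q * q'" by (metis dvdE gcd_dvd1 gcd_dvd2)
  define g where "g = nat (gcd p q)"
  have g: "real g = real_of_int (gcd p q)" by (simp add: g_def)
  have "real_of_int p = real g * real_of_int p'" "real_of_int q = real g * real_of_int q'"
    unfolding g using pq by (metis of_int_mult)+
  then have "lattice_vec k p q = real g *\<^sub>R lattice_vec k p' q'"
    by (simp add: vec_eq_iff forall_2 algebra_simps)
  moreover have "lattice_vec k p' q' \<in> lattice_points" by (simp add: lattice_points_def forall_2)
  ultimately have "g = 1" using assms unfolding primitive_def by blast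
  then show ?thesis by (simp add: g_def coprime_iff_gcd_eq_1)
qed

text \<open>A shear has determinant \<open>1\<close>: it only translates the chords along the second axis.\<close>

lemma measure_dual_coords:
  assumes "S \<in> sets lborel"
  shows "measure lborel S = measure lborel {w. dual_vec k w \<in> S}"
proof -
  let ?T = "dual_vec k"
  have "continuous_on UNIV ?T" unfolding dual_vec_def by (intro continuous_intros)
  then have T[measurable]: "?T \<in> borel_measurable borel" by (rule borel_measurable_continuous_onI)
  have B: "(Basis :: (real^2) set) = {axis 1 1, axis 2 1}" by (auto simp: Basis_vec_def UNIV_2)
  have "lborel = distr lborel borel ?T"
  proof (rule lborel_eqI)
    fix l u :: "real^2"
    assume "\<And>b. b \<in> Basis \<Longrightarrow> l \<bullet> b \<le> u \<bullet> b"
    from this[of "axis 1 1"] this[of "axis 2 1"]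
    have lu: "l $ 1 \<le> u $ 1" "l $ 2 \<le> u $ 2" by (simp_all add: B inner_axis)
    let ?A = "?T -` box l u"
    have A: "?A \<in> sets (lborel \<Otimes>\<^sub>M lborel)"
      unfolding lborel_prod sets_lborel using measurable_sets[OF T, of "box l u"] by simp
    have "emeasure (distr lborel borel ?T) (box l u) = emeasure (lborel \<Otimes>\<^sub>M lborel) ?A"
      by (subst emeasure_distr) (simp_all add: lborel_prod)
    also have "\<dots> = (\<integral>\<^sup>+ x. emeasure lborel (Pair x -` ?A) \<partial>lborel)"
      by (rule lborel.emeasure_pair_measure_alt[OF A])
    also have "\<dots> = (\<integral>\<^sup>+ x. ennreal (u $ 2 - l $ 2) * indicator {l $ 1<..<u $ 1} x \<partial>lborel)"
    proof (rule nn_integral_cong)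
      fix x :: real
      have "Pair x -` ?A = (if x \<in> {l $ 1<..<u $ 1} then {l $ 2 + real_of_int k * x<..<u $ 2 + real_of_int k * x} else {})"
        by (auto simp: mem_box_cart forall_2 )
      then show "emeasure lborel (Pair x -` ?A) = ennreal (u $ 2 - l $ 2) * indicator {l $ 1<..<u $ 1} x"
        using lu by simp
    qed
    also have "\<dots> = ennreal ((u $ 2 - l $ 2) * (u $ 1 - l $ 1))"
      using lu by (simp add: nn_integral_cmult_indicator ennreal_mult)
    also have "(u $ 2 - l $ 2) * (u $ 1 - l $ 1) = (\<Prod>b\<in>Basis. (u - l) \<bullet> b)"
      by (simp add: B axis_eq_axis inner_axis)
    finally show "emeasure (distr lborel borel ?T) (box l u) = (\<Prod>b\<in>Basis. (u - l) \<bullet> b)" .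
  qed simp
  then have "measure lborel S = measure (distr lborel borel ?T) S" by simp
  also have "\<dots> = measure lborel (?T -` S)"
    using assms by (subst measure_distr) simp_all
  finally show ?thesis by (simp add: vimage_def)
qed

section \<open>The lattice sum and the second moment of a Fano polygon\<close>

text \<open>The shear is chosen so that all facet normals have distinct nonzero second coordinates. A direction in which
two normals attain the Newton function is that of a vertex, and the vertex is primitive; this supplies the
coprime pairs \<open>(p, q)\<close>. The polar polygon is the convex set with support function \<open>\<nu>\<close>.\<close>

lemma fano_lattice_sum:
  assumes P: "fano_polytope P"
  shows "\<exists>H. has_const_term H (measure lebesgue (polar P) / 6) \<and>
    (\<forall>t>0. geo_spectrum P (exp t) = (exp t - 1)\<^sup>2 * H t)"
proof -
  define U where "U = facet_normals P"
  note U = fano_polytope_facet_normals(1-3)[OF P, folded U_def] newton_function_eq_Max[of P, folded U_def]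
    fano_polytope_facet_normals(4)[OF P, folded U_def]
  let ?\<nu> = "newton_function P"
  have \<nu>_ge: "u \<bullet> v \<le> ?\<nu> v" if "u \<in> U" for u v unfolding U(4) using U(1) that by simp
  have \<nu>_att: "\<exists>u\<in>U. ?\<nu> v = u \<bullet> v" for v
  proof -
    have "?\<nu> v \<in> (\<lambda>u. u \<bullet> v) ` U" unfolding U(4) using U by (intro Max_in) auto
    then show ?thesis by blast
  qed
  have \<nu>_pos: "?\<nu> v > 0" if v: "v \<noteq> 0" for v
  proof (rule ccontr)
    assume "\<not> ?\<nu> v > 0"
    then have le: "u \<bullet> v \<le> 0" if "u \<in> U" for u using \<nu>_ge[OF that, of v] by linarith
    obtain S where "finite S" "P = convex hull S"
      using P by (auto simp: fano_polytope_def lattice_polytope_def)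
    then have "bounded P" using finite_imp_bounded bounded_convex_hull by blast
    then obtain B where B: "\<forall>x\<in>P. norm x \<le> B" by (auto simp: bounded_iff)
    \<comment> \<open>A direction with nonpositive \<open>\<nu>\<close> would span an unbounded ray inside \<open>P\<close>.\<close>
    define c where "c = (\<bar>B\<bar> + 1) / norm v"
    have c: "c > 0" "norm (c *\<^sub>R v) = \<bar>B\<bar> + 1" using v by (simp_all add: c_def)
    have "u \<bullet> (c *\<^sub>R v) \<le> 1" if "u \<in> U" for u
      using mult_nonneg_nonpos[of c "u \<bullet> v"] c le[OF that] by simp
    then have "c *\<^sub>R v \<in> P" using U(5) by blast
    then have "norm (c *\<^sub>R v) \<le> B" using B by blast
    then show False using c(2) by linarith
  qed
  have unit: "(1 / ?\<nu> v) *\<^sub>R v \<in> P" if "v \<noteq> 0" for v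
  proof -
    have "u \<bullet> ((1 / ?\<nu> v) *\<^sub>R v) \<le> 1" if "u \<in> U" for u
      using \<nu>_ge[OF that, of v] \<nu>_pos[OF \<open>v \<noteq> 0\<close>] by simp
    then show ?thesis using U(5) by blast
  qed
  \<comment> \<open>Nonzero second coordinates of the normals give geometric series of ratio different from \<open>1\<close> on every
    vertical line, and those of their differences mean that no vertex lies on the line of abscissa \<open>0\<close>.\<close>
  obtain k where k: "\<And>d. d \<in> U \<union> (\<lambda>(u, u'). u - u') ` (U \<times> U) - {0} \<Longrightarrow> snd (dual_coords k d) \<noteq> 0"
    by (rule generic_shear[of "U \<union> (\<lambda>(u, u'). u - u') ` (U \<times> U) - {0}"]) (use U(1) in auto)
  define W where "W = dual_coords k ` U"
  have W: "finite W" "W \<noteq> {}" using U by (auto simp: W_def)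
  have supp: "support W x y = ?\<nu> (lattice_vec k x y)" for x y
    unfolding support_def W_def U(4) by (simp add: image_image inner_lattice_vec)
  have inj: "inj_on snd W"
  proof (rule inj_onI)
    fix w w' assume w: "w \<in> W" "w' \<in> W" "snd w = snd w'"
    then obtain u u' where u: "u \<in> U" "u' \<in> U" "w = dual_coords k u" "w' = dual_coords k u'" by (auto simp: W_def)
    have "snd (dual_coords k (u - u')) = 0" using w(3) u by (simp add: dual_coords_def algebra_simps)
    moreover have "u - u' \<in> (\<lambda>(u, u'). u - u') ` (U \<times> U)" using u by force
    ultimately have "u - u' = 0" using k by blast
    then show "w = w'" using u by simp
  qed
  have nz: "snd w \<noteq> 0" if w: "w \<in> W" for w
  proof -
    obtain u where "u \<in> U" "w = dual_coords k u" using w by (auto simp: W_def)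
    then show ?thesis using k[of u] U(3) by blast
  qed
  have "lattice_vec k 0 1 \<noteq> 0" "lattice_vec k 0 (- 1) \<noteq> 0" by (simp_all add: vec_eq_iff forall_2)
  from this[THEN \<nu>_pos] obtain u1 u0 where "u1 \<in> U" "u1 \<bullet> lattice_vec k 0 1 > 0"
    "u0 \<in> U" "u0 \<bullet> lattice_vec k 0 (- 1) > 0"
    using \<nu>_att[of "lattice_vec k 0 1"] \<nu>_att[of "lattice_vec k 0 (- 1)"] by auto
  then have ends: "dual_coords k u0 \<in> W" "snd (dual_coords k u0) < 0" "dual_coords k u1 \<in> W" "snd (dual_coords k u1) > 0"
    by (auto simp: W_def inner_lattice_vec)
  have kinks: "\<forall>w\<in>W. \<forall>w'\<in>W. \<forall>x y. w \<noteq> w' \<and> x \<noteq> 0 \<and>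
      fst w * x + snd w * y = support W x y \<and> fst w' * x + snd w' * y = support W x y \<longrightarrow>
      (\<exists>p q c. coprime p q \<and> c > 0 \<and> x = c * real_of_int p \<and> y = c * real_of_int q \<and> support W p q = 1)"
  proof (intro ballI allI impI, elim conjE)
    fix w w' x y
    assume w: "w \<in> W" "w' \<in> W" "w \<noteq> w'" "x \<noteq> 0" "fst w * x + snd w * y = support W x y" "fst w' * x + snd w' * y = support W x y"
    obtain u u' where u: "u \<in> U" "u' \<in> U" "w = dual_coords k u" "w' = dual_coords k u'" "u \<noteq> u'"
      using w(1-3) by (auto simp: W_def)
    define v where "v = lattice_vec k x y"
    have "v \<noteq> 0"
    proof
      assume "v = 0"
      then have "v $ 1 = 0" "v $ 2 = 0" by simp_all
      then show False using w(4) by (simp add: v_def)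
    qed
    define c where "c = ?\<nu> v"
    have c: "c > 0" using \<nu>_pos[OF \<open>v \<noteq> 0\<close>] by (simp add: c_def)
    have uv: "u \<bullet> v = c" "u' \<bullet> v = c"
      using w(5,6) u(3,4) by (simp_all add: v_def c_def inner_lattice_vec supp)
    define z where "z = (1 / c) *\<^sub>R v"
    have "primitive z"
      using uv c unit[OF \<open>v \<noteq> 0\<close>] by (intro fano_polytope_vertex[OF P U(5) u(1,2,5)]) (simp_all add: z_def c_def)
    then have "z \<in> lattice_points" by (simp add: primitive_def)
    then have "z \<in> range (\<lambda>(x::int, y::int). lattice_vec k x y)"
      using bij_betw_imp_surj_on[OF bij_betw_lattice_vec] by simp
    then obtain p q :: int where pq: "z = lattice_vec k p q" by auto
    have v: "v = c *\<^sub>R z" using c by (simp add: z_def)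
    have y: "y = c * q" using arg_cong[OF v, of "\<lambda>v. v $ 2"] by (simp add: pq v_def)
    moreover have "x = c * p" using arg_cong[OF v, of "\<lambda>v. v $ 1"] y by (simp add: pq v_def algebra_simps)
    moreover have "coprime p q" using \<open>primitive z\<close> pq primitive_coprime by simp
    moreover have "support W p q = 1"
    proof -
      have "c * support W p q = support W x y" using support_scale[OF W, of c p q] c calculation by simp
      then show ?thesis using c by (simp add: supp c_def v_def)
    qed
    ultimately show "\<exists>p q c. coprime p q \<and> c > 0 \<and> x = c * real_of_int p \<and> y = c * real_of_int q \<and> support W p q = 1"
      using c by blast
  qed
  from lattice_sum_const_term[OF W(1) inj nz ends kinks]
  obtain H where H: "\<And>t. t > 0 \<Longrightarrow> ((\<lambda>(x, y). exp (- t * support W (real_of_int x) (real_of_int y))) has_sum H t) UNIV"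
    "has_const_term H (measure lborel (common_minorants (envelope W) (envelope (flip ` W))) / 6)"
    by blast
  have polar_iff: "m \<in> polar P \<longleftrightarrow> (\<forall>v. m \<bullet> v \<le> ?\<nu> v)" for m
  proof
    assume m: "m \<in> polar P"
    show "\<forall>v. m \<bullet> v \<le> ?\<nu> v"
    proof
      fix v show "m \<bullet> v \<le> ?\<nu> v"
      proof (cases "v = 0")
        case False
        then have "m \<bullet> ((1 / ?\<nu> v) *\<^sub>R v) \<le> 1" using m unit[OF False] unfolding polar_def by blast
        then show ?thesis using \<nu>_pos[OF False] by (simp add: field_simps)
      qed (use \<nu>_att[of 0] in auto)
    qed
  next
    assume m: "\<forall>v. m \<bullet> v \<le> ?\<nu> v"
    have "m \<bullet> x \<le> 1" if "x \<in> P" for x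
    proof -
      obtain u where "u \<in> U" "?\<nu> x = u \<bullet> x" using \<nu>_att by blast
      then have "?\<nu> x \<le> 1" using that U(5) by auto
      then show ?thesis using m[rule_format, of x] by linarith
    qed
    then show "m \<in> polar P" by (simp add: polar_def)
  qed
  have "closed (polar P)"
  proof -
    have "polar P = (\<Inter>x\<in>P. {m. m \<bullet> x \<le> 1})" by (auto simp: polar_def)
    then show ?thesis by (auto intro!: closed_INT closed_Collect_le continuous_intros)
  qed
  then have meas: "polar P \<in> sets lborel" by (simp add: borel_closed)
  have "dual_vec k w \<in> polar P \<longleftrightarrow> w \<in> common_minorants (envelope W) (envelope (flip ` W))" for w
  proof -
    have "dual_vec k w \<in> polar P \<longleftrightarrow> (\<forall>x y. dual_vec k w \<bullet> lattice_vec k x y \<le> ?\<nu> (lattice_vec k x y))"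
      unfolding polar_iff using lattice_vec_coords[of k] by metis
    then show ?thesis unfolding common_minorants_iff[OF W] by (simp add: inner_lattice_vec supp)
  qed
  then have "measure lebesgue (polar P) = measure lborel (common_minorants (envelope W) (envelope (flip ` W)))"
    using measure_dual_coords[OF meas, of k] measure_completion[OF meas] by simp
  moreover have "geo_spectrum P (exp t) = (exp t - 1)\<^sup>2 * H t" if "t > 0" for t
  proof -
    have "(\<Sum>\<^sub>\<infinity>v\<in>lattice_points. exp t powr (- ?\<nu> v)) = (\<Sum>\<^sub>\<infinity>v\<in>lattice_points. exp (- t * ?\<nu> v))"
      by (simp add: powr_def mult.commute)
    also have "\<dots> = (\<Sum>\<^sub>\<infinity>(x, y)\<in>(UNIV :: (int \<times> int) set). exp (- t * support W (real_of_int x) (real_of_int y)))"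
      using infsum_reindex_bij_betw[OF bij_betw_lattice_vec[of k], of "\<lambda>v. exp (- t * ?\<nu> v)"]
      by (simp add: supp case_prod_unfold)
    also have "\<dots> = H t" using H(1)[OF that] by (rule infsumI)
    finally show ?thesis by (simp add: geo_spectrum_def)
  qed
  ultimately show ?thesis using H(2) by auto
qed

theorem theorem8p1:
  fixes P :: "(real^2) set" and \<mu> :: nat and \<beta> :: "nat \<Rightarrow> real"
  assumes "fano_polytope P"
    and "real \<mu> = normalized_volume P"
    and "\<forall>i\<in>{1..\<mu>}. \<beta> i \<in> \<rat> \<and> 0 \<le> \<beta> i"
    and "mono_on {1..\<mu>} \<beta>"
    and "\<forall>z>1. geo_spectrum P z = (\<Sum>i=1..\<mu>. z powr \<beta> i)"
  shows "(\<Sum>i=1..\<mu>. (\<beta> i - 1)^2) = normalized_volume P / 6 + normalized_volume (polar P) / 6"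
proof -
  obtain H where H: "has_const_term H (measure lebesgue (polar P) / 6)"
    "\<And>t. t > 0 \<Longrightarrow> geo_spectrum P (exp t) = (exp t - 1)\<^sup>2 * H t"
    using fano_lattice_sum[OF assms(1)] by blast
  have "(\<Sum>i=1..\<mu>. exp (t * \<beta> i)) = (exp t - 1)\<^sup>2 * H t" if "t > 0" for t
  proof -
    have "geo_spectrum P (exp t) = (\<Sum>i=1..\<mu>. exp t powr \<beta> i)" using assms(5) that by simp
    then show ?thesis using H(2)[OF that] by (simp add: powr_def mult.commute)
  qed
  from second_moment_of_const_term[OF H(1) this]
  have "(\<Sum>i=1..\<mu>. (\<beta> i - 1)\<^sup>2) = real \<mu> / 6 + measure lebesgue (polar P) / 3" by simp
  then show ?thesis using assms(2) by (simp add: normalized_volume_def)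
qed

end
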